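(* Let $(\Omega,\mathcal F,\mathbb P,\theta)$ be an ergodic metric dynamical system with time set $\mathbb R$, $H$ a separable Hilbert space, and $U$ the linear random dynamical system on $H$ generated by $\frac{du}{dt}+A(\theta_t\omega)u=0$. Assume: (A) $U$ is nonuniformly pseudo-hyperbolic, with invariant set $\tilde\Omega$, splitting $H=E^s(\omega)\oplus E^u(\omega)$, projections $\Pi^s,\Pi^u$, $\theta$-invariant random variables $\alpha(\omega)>\beta(\omega)$ and tempered $K:\tilde\Omega\to[1,\infty)$ (see context). (B) There are a random variable $\rho_0:\Omega\to(0,\infty)$ tempered from below with $t\mapsto\rho_0(\theta_t\omega)$ locally integrable, a number $\varepsilon\in(0,1]$, and a random variable $\tilde B_1$ tempered from above with $t\mapsto\tilde B_1(\theta_t\omega)$ locally integrable, such that, with $\mathcal N(\omega)=\{u\in H:\|u\|<\rho_0(\omega)\}$, the map $F(\omega,\cdot):\mathcal N(\omega)\to H$ (measurable in $\omega$) is Lipschitz continuous, $F(\omega,0)=0$ and $$\|F(\omega,u)-F(\omega,v)\|\le\tilde B_1(\omega)\big(\|u\|^\varepsilon+\|v\|^\varepsilon\big)\|u-v\|,\qquad \omega\in\Omega,\ u,v\in\mathcal N(\omega).$$ Let $\rho:\Omega\to(0,\infty)$ be a random variable tempered from below with $t\mapsto\rho(\theta_t\omega)$ locally integrable and $2\rho\le\rho_0$, let $F_\rho$ be the cut-off of $F$ (see context), let $B_1>0$ be a random variable tempered from above, with $t\mapsto B_1(\theta_t\omega)$ locally integrable, such that $\|F_\rho(\omega,u)-F_\rho(\omega,v)\|\le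 B_1(\omega)\rho(\omega)^\varepsilon\|u-v\|$ for all $u,v\in H$, and suppose $$0<\rho(\omega)<\Big(\frac{\alpha(\omega)-\beta(\omega)}{8K(\omega)B_1(\omega)}\Big)^{1/\varepsilon}.$$ Then the equation $\frac{du}{dt}+A(\theta_t\omega)u=F_\rho(\theta_t\omega,u)$ has a Lipschitz pseudo-stable manifold: for every $\omega$ in a $\theta$-invariant set of full measure, the set $M^s(\omega)$ (defined in the context) satisfies $$M^s(\omega)=\{q+h^s(\omega,q)\ :\ q\in E^s(\omega)\},$$ where $h^s(\omega,\cdot):E^s(\omega)\to E^u(\omega)$ is Lipschitz continuous and $h^s(\omega,0)=0$.
   Context: Metric dynamical system: a probability space $(\Omega,\mathcal F,\mathbb P)$ with a measurable flow $\theta:\mathbb R\times\Omega\to\Omega$ ($\theta_0=\mathrm{id}$, $\theta_t\theta_s=\theta_{t+s}$) under which $\mathbb P$ is invariant and ergodic. Linear random dynamical system generated by the linear equation: bounded linear operators $U(t,\omega)$ on $H$, $t\ge0$, jointly measurable in $(t,\omega,x)$, with $U(0,\omega)=\mathrm{id}$ and $U(t+\tau,\omega)=U(t,\theta_\tau\omega)U(\tau,\omega)$, such that $U_\omega(t,s):=U(t-s,\theta_s\omega)$, $t\ge s$, is the fundamental solution (evolution operator) of $\frac{du}{dt}+A(\theta_t\omega)u=0$; in particular $(t,s)\mapsto U_\omega(t,s)x$ is continuous for every $x\in H$. Solutions of nonlinear equations $\frac{du}{dt}+A(\theta_t\omega)u=G(\theta_t\omega,u)$ are mild solutions: $u(t)=U(t-s,\theta_s\omega)u(s)+\int_s^tU(t-\tau,\theta_\tau\omega)G(\theta_\tau\omega,u(\tau))\,d\tau$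 for $s\le t$. Tempered (from above): $X:\Omega\to(0,\infty)$ is tempered if $\lim_{t\to\infty}\frac{\log^+X(\theta_t\omega)}t=0$ on a $\theta$-invariant set of full measure; tempered from below means $X^{-1}$ is tempered. Nonuniformly pseudo-hyperbolic: there is a $\theta$-invariant set $\tilde\Omega\subset\Omega$ of full measure such that for each $\omega\in\tilde\Omega$, $H=E^s(\omega)\oplus E^u(\omega)$ with closed subspaces satisfying: (i) for $t\ge0$, $U(t,\omega)E^s(\omega)\subset E^s(\theta_t\omega)$, $U(t,\omega)E^u(\omega)\subset E^u(\theta_t\omega)$, and $U(t,\omega)|_{E^u(\omega)}$ is an isomorphism from $E^u(\omega)$ to $E^u(\theta_t\omega)$; (ii) there are $\theta$-invariant random variables $\alpha(\omega)>\beta(\omega)$ and a tempered random variable $K:\tilde\Omega\to[1,\infty)$ with $$\|U(t,\omega)\Pi^s(\omega)\|\le K(\omega)e^{\beta(\omega)t}\ (t\ge0),\qquad \big\|\big(U(-t,\theta_t\omega)|_{E^u(\theta_t\omega)}\big)^{-1}\Pi^u(\omega)\big\|\le K(\omega)e^{\alpha(\omega)t}\ (t\le0),$$ where $\Pi^s(\omega),\Pi^u(\omega)$ are the measurable projections associated with the splitting. Cut-off: fix a $C^\infty$ function $\sigma:\mathbb R\to[0,1]$ with $\sigma(s)=1$ for $|s|\le1$, $\sigma(s)=0$ for $|s|\ge2$, $\sup|\sigma'|\le2$, and set $F_\rho(\omega,u)=\sigma(\|u\|/\rho(\omega))F(\omega,u)$ (interpreted as $0$ where $\|u\|\ge2\rho(\omega)$).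 Pseudo-stable set: let $\gamma(\omega)=\frac{\alpha(\omega)+\beta(\omega)}2$ and let $C_\gamma^+$ be the Banach space of continuous $u:[0,\infty)\to H$ with $\sup_{t\ge0}\|e^{-\gamma(\omega)t}u(t)\|<\infty$. With $u(\cdot,\omega,u^0)$ the solution of $\frac{du}{dt}+A(\theta_t\omega)u=F_\rho(\theta_t\omega,u)$ with $u(0)=u^0$, set $M^s(\omega)=\{u^0\in H: u(\cdot,\omega,u^0)\in C_\gamma^+\}$. It is called a Lipschitz pseudo-stable manifold if it is the graph of a Lipschitz function. *)

theory Defs
  imports "HOL-Probability.Probability"
begin

definition flow_invariant :: "'w measure \<Rightarrow> (real \<Rightarrow> 'w \<Rightarrow> 'w) \<Rightarrow> 'w set \<Rightarrow> bool" where
  "flow_invariant M \<theta> S \<longleftrightarrow> S \<in> sets M \<and> (\<forall>t. \<theta> t -` S \<inter> space M = S)"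

definition invariant_full :: "'w measure \<Rightarrow> (real \<Rightarrow> 'w \<Rightarrow> 'w) \<Rightarrow> 'w set \<Rightarrow> bool" where
  "invariant_full M \<theta> S \<longleftrightarrow> flow_invariant M \<theta> S \<and> measure M S = 1"

locale ergodic_mds = prob_space M
  for M :: "'w measure" and \<theta> :: "real \<Rightarrow> 'w \<Rightarrow> 'w" +
  assumes flow_measurable: "(\<lambda>(t, \<omega>). \<theta> t \<omega>) \<in> measurable (borel \<Otimes>\<^sub>M M) M"
    and flow_0: "\<And>\<omega>. \<omega> \<in> space M \<Longrightarrow> \<theta> 0 \<omega> = \<omega>"
    and flow_add: "\<And>t s \<omega>. \<omega> \<in> space M \<Longrightarrow> \<theta> t (\<theta> s \<omega>) = \<theta> (t + s) \<omega>"
    and measure_invariant: "\<And>t. distr M M (\<theta> t) = M"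
    and ergodic: "\<And>S. flow_invariant M \<theta> S \<Longrightarrow> prob S = 0 \<or> prob S = 1"

definition tempered :: "'w measure \<Rightarrow> (real \<Rightarrow> 'w \<Rightarrow> 'w) \<Rightarrow> ('w \<Rightarrow> real) \<Rightarrow> bool" where
  "tempered M \<theta> X \<longleftrightarrow>
     (\<exists>S. invariant_full M \<theta> S \<and>
       (\<forall>\<omega>\<in>S. ((\<lambda>t. max 0 (ln (X (\<theta> t \<omega>))) / t) \<longlongrightarrow> 0) at_top))"

definition tempered_below :: "'w measure \<Rightarrow> (real \<Rightarrow> 'w \<Rightarrow> 'w) \<Rightarrow> ('w \<Rightarrow> real) \<Rightarrow> bool" where
  "tempered_below M \<theta> X \<longleftrightarrow> tempered M \<theta> (\<lambda>\<omega>. inverse (X \<omega>))"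

definition path_locally_integrable ::
    "'w measure \<Rightarrow> (real \<Rightarrow> 'w \<Rightarrow> 'w) \<Rightarrow> ('w \<Rightarrow> real) \<Rightarrow> bool" where
  "path_locally_integrable M \<theta> X \<longleftrightarrow>
     (\<forall>\<omega>\<in>space M. \<forall>a b. set_integrable lborel {a..b} (\<lambda>t. X (\<theta> t \<omega>)))"

definition pos_random_variable :: "'w measure \<Rightarrow> ('w \<Rightarrow> real) \<Rightarrow> bool" where
  "pos_random_variable M X \<longleftrightarrow> X \<in> borel_measurable M \<and> (\<forall>\<omega>\<in>space M. 0 < X \<omega>)"

text \<open>
  The operators \<open>A t\<close>, with dense domains \<open>D t\<close>, are in general unbounded. A fundamental solution
  is a strongly continuous evolution family \<open>V t s\<close> (for \<open>s \<le> t\<close>) yielding classical solutions of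
  \<open>u' + A t u = 0\<close> for initial values in the domain.
\<close>

definition fundamental_solution ::
    "(real \<Rightarrow> 'h::{real_inner, banach} set) \<Rightarrow> (real \<Rightarrow> 'h \<Rightarrow> 'h) \<Rightarrow> (real \<Rightarrow> real \<Rightarrow> 'h \<Rightarrow> 'h) \<Rightarrow> bool"
  where
  "fundamental_solution D A V \<longleftrightarrow>
     (\<forall>t. subspace (D t) \<and> closure (D t) = UNIV
        \<and> (\<forall>x\<in>D t. \<forall>y\<in>D t. A t (x + y) = A t x + A t y)
        \<and> (\<forall>c. \<forall>x\<in>D t. A t (c *\<^sub>R x) = c *\<^sub>R A t x))
   \<and> (\<forall>s t. s \<le> t \<longrightarrow> bounded_linear (V t s))
   \<and> (\<forall>s x. V s s x = x)
   \<and> (\<forall>r s t x. r \<le> s \<longrightarrow> s \<le> t \<longrightarrow> V t s (V s r x) = V t r x)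
   \<and> (\<forall>x. continuous_on {(t, s). s \<le> t} (\<lambda>(t, s). V t s x))
   \<and> (\<forall>s. \<forall>x\<in>D s. \<forall>t>s. V t s x \<in> D t \<and>
        ((\<lambda>r. V r s x) has_vector_derivative - A t (V t s x)) (at t))"

locale linear_rds = ergodic_mds M \<theta>
  for M :: "'w measure" and \<theta> :: "real \<Rightarrow> 'w \<Rightarrow> 'w" +
  fixes D :: "'w \<Rightarrow> 'h::{real_inner, banach, second_countable_topology} set"
    and A :: "'w \<Rightarrow> 'h \<Rightarrow> 'h"
    and U :: "real \<Rightarrow> 'w \<Rightarrow> 'h \<Rightarrow> 'h"
  assumes bounded_linear_U: "\<And>t \<omega>. 0 \<le> t \<Longrightarrow> \<omega> \<in> space M \<Longrightarrow> bounded_linear (U t \<omega>)"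
    and measurable_U: "(\<lambda>(t, \<omega>, x). U t \<omega> x)
          \<in> borel_measurable (restrict_space borel {0..} \<Otimes>\<^sub>M M \<Otimes>\<^sub>M borel)"
    and U_0: "\<And>\<omega> x. \<omega> \<in> space M \<Longrightarrow> U 0 \<omega> x = x"
    and cocycle: "\<And>t \<tau> \<omega> x. 0 \<le> t \<Longrightarrow> 0 \<le> \<tau> \<Longrightarrow> \<omega> \<in> space M \<Longrightarrow>
          U (t + \<tau>) \<omega> x = U t (\<theta> \<tau> \<omega>) (U \<tau> \<omega> x)"
    and generated: "\<And>\<omega>. \<omega> \<in> space M \<Longrightarrow>
          fundamental_solution (\<lambda>t. D (\<theta> t \<omega>)) (\<lambda>t. A (\<theta> t \<omega>)) (\<lambda>t s. U (t - s) (\<theta> s \<omega>))"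

definition splitting_projections ::
    "'h::real_normed_vector set \<Rightarrow> 'h set \<Rightarrow> ('h \<Rightarrow> 'h) \<Rightarrow> ('h \<Rightarrow> 'h) \<Rightarrow> bool" where
  "splitting_projections E1 E2 P1 P2 \<longleftrightarrow>
     subspace E1 \<and> closed E1 \<and> subspace E2 \<and> closed E2 \<and> E1 \<inter> E2 = {0}
   \<and> bounded_linear P1 \<and> bounded_linear P2
   \<and> (\<forall>x. P1 x \<in> E1 \<and> P2 x \<in> E2 \<and> x = P1 x + P2 x)"

text \<open>
  All random objects of the dichotomy (\<open>Es\<close>, \<open>Eu\<close>, \<open>Ps\<close>, \<open>Pu\<close>, \<open>\<alpha>\<close>, \<open>\<beta>\<close>, \<open>K\<close>) are only
  constrained on the invariant set \<open>\<Omega>'\<close> of full measure. For \<open>t \<le> 0\<close> the map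
  \<open>inv_into (Eu (\<theta> t \<omega>)) (U (- t) (\<theta> t \<omega>))\<close> is the inverse of the restriction of
  \<open>U (- t) (\<theta> t \<omega>)\<close> to \<open>Eu (\<theta> t \<omega>)\<close>; it is defined on \<open>Eu \<omega>\<close>.
\<close>

definition pseudo_hyperbolic ::
    "'w measure \<Rightarrow> (real \<Rightarrow> 'w \<Rightarrow> 'w)
     \<Rightarrow> (real \<Rightarrow> 'w \<Rightarrow> 'h::{real_inner, banach, second_countable_topology} \<Rightarrow> 'h) \<Rightarrow> 'w set
     \<Rightarrow> ('w \<Rightarrow> 'h set) \<Rightarrow> ('w \<Rightarrow> 'h set) \<Rightarrow> ('w \<Rightarrow> 'h \<Rightarrow> 'h) \<Rightarrow> ('w \<Rightarrow> 'h \<Rightarrow> 'h)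
     \<Rightarrow> ('w \<Rightarrow> real) \<Rightarrow> ('w \<Rightarrow> real) \<Rightarrow> ('w \<Rightarrow> real) \<Rightarrow> bool" where
  "pseudo_hyperbolic M \<theta> U \<Omega>' Es Eu Ps Pu \<alpha> \<beta> K \<longleftrightarrow>
     invariant_full M \<theta> \<Omega>'
   \<and> (\<forall>\<omega>\<in>\<Omega>'. splitting_projections (Es \<omega>) (Eu \<omega>) (Ps \<omega>) (Pu \<omega>))
   \<and> (\<forall>x. (\<lambda>\<omega>. Ps \<omega> x) \<in> borel_measurable (restrict_space M \<Omega>'))
   \<and> (\<forall>x. (\<lambda>\<omega>. Pu \<omega> x) \<in> borel_measurable (restrict_space M \<Omega>'))
   \<and> (\<forall>\<omega>\<in>\<Omega>'. \<forall>t\<ge>0.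
        U t \<omega> ` Es \<omega> \<subseteq> Es (\<theta> t \<omega>) \<and> U t \<omega> ` Eu \<omega> \<subseteq> Eu (\<theta> t \<omega>)
      \<and> homeomorphism (Eu \<omega>) (Eu (\<theta> t \<omega>)) (U t \<omega>) (inv_into (Eu \<omega>) (U t \<omega>)))
   \<and> \<alpha> \<in> borel_measurable (restrict_space M \<Omega>')
   \<and> \<beta> \<in> borel_measurable (restrict_space M \<Omega>')
   \<and> K \<in> borel_measurable (restrict_space M \<Omega>')
   \<and> (\<forall>\<omega>\<in>\<Omega>'. \<forall>t. \<alpha> (\<theta> t \<omega>) = \<alpha> \<omega> \<and> \<beta> (\<theta> t \<omega>) = \<beta> \<omega>)
   \<and> (\<forall>\<omega>\<in>\<Omega>'. \<beta> \<omega> < \<alpha> \<omega>)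
   \<and> (\<forall>\<omega>\<in>\<Omega>'. 1 \<le> K \<omega>)
   \<and> tempered M \<theta> K
   \<and> (\<forall>\<omega>\<in>\<Omega>'. \<forall>t\<ge>0. onorm (\<lambda>x. U t \<omega> (Ps \<omega> x)) \<le> K \<omega> * exp (\<beta> \<omega> * t))
   \<and> (\<forall>\<omega>\<in>\<Omega>'. \<forall>t\<le>0.
        onorm (\<lambda>x. inv_into (Eu (\<theta> t \<omega>)) (U (- t) (\<theta> t \<omega>)) (Pu \<omega> x))
          \<le> K \<omega> * exp (\<alpha> \<omega> * t))"

definition cutoff_function :: "(real \<Rightarrow> real) \<Rightarrow> bool" where
  "cutoff_function \<sigma> \<longleftrightarrow>
     (\<forall>n s. ((deriv ^^ n) \<sigma>) field_differentiable (at s))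
   \<and> (\<forall>s. \<sigma> s \<in> {0..1})
   \<and> (\<forall>s. \<bar>s\<bar> \<le> 1 \<longrightarrow> \<sigma> s = 1)
   \<and> (\<forall>s. 2 \<le> \<bar>s\<bar> \<longrightarrow> \<sigma> s = 0)
   \<and> (\<forall>s. \<bar>deriv \<sigma> s\<bar> \<le> 2)"

definition cutoff ::
    "(real \<Rightarrow> real) \<Rightarrow> ('w \<Rightarrow> real) \<Rightarrow> ('w \<Rightarrow> 'h::real_normed_vector \<Rightarrow> 'h) \<Rightarrow> 'w \<Rightarrow> 'h \<Rightarrow> 'h" where
  "cutoff \<sigma> \<rho> F \<omega> u =
     (if norm u < 2 * \<rho> \<omega> then \<sigma> (norm u / \<rho> \<omega>) *\<^sub>R F \<omega> u else 0)"

definition mild_solution ::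
    "(real \<Rightarrow> 'w \<Rightarrow> 'w) \<Rightarrow> (real \<Rightarrow> 'w \<Rightarrow> 'h::{real_inner, banach, second_countable_topology} \<Rightarrow> 'h)
     \<Rightarrow> ('w \<Rightarrow> 'h \<Rightarrow> 'h) \<Rightarrow> 'w \<Rightarrow> (real \<Rightarrow> 'h) \<Rightarrow> bool" where
  "mild_solution \<theta> U G \<omega> u \<longleftrightarrow>
     continuous_on {0..} u
   \<and> (\<forall>s t. 0 \<le> s \<longrightarrow> s \<le> t \<longrightarrow>
        set_integrable lborel {s..t} (\<lambda>\<tau>. U (t - \<tau>) (\<theta> \<tau> \<omega>) (G (\<theta> \<tau> \<omega>) (u \<tau>)))
      \<and> u t = U (t - s) (\<theta> s \<omega>) (u s)
              + (LINT \<tau>:{s..t}|lborel. U (t - \<tau>) (\<theta> \<tau> \<omega>) (G (\<theta> \<tau> \<omega>) (u \<tau>))))"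

text \<open>
  The solution on \<open>[0, \<infinity>)\<close> with initial value \<open>u0\<close>. A function of type \<open>real \<Rightarrow> 'h\<close> is
  determined by the equation on \<open>{0..}\<close> only; prescribing \<open>0\<close> at negative times makes the
  definite description meaningful.
\<close>

definition the_solution ::
    "(real \<Rightarrow> 'w \<Rightarrow> 'w) \<Rightarrow> (real \<Rightarrow> 'w \<Rightarrow> 'h::{real_inner, banach, second_countable_topology} \<Rightarrow> 'h)
     \<Rightarrow> ('w \<Rightarrow> 'h \<Rightarrow> 'h) \<Rightarrow> 'w \<Rightarrow> 'h \<Rightarrow> real \<Rightarrow> 'h" where
  "the_solution \<theta> U G \<omega> u0 =
     (THE u. mild_solution \<theta> U G \<omega> u \<and> u 0 = u0 \<and> (\<forall>t<0. u t = 0))"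

definition C_plus :: "real \<Rightarrow> (real \<Rightarrow> 'h::real_normed_vector) set" where
  "C_plus \<gamma> =
     {u. continuous_on {0..} u \<and> bdd_above ((\<lambda>t. norm (exp (- \<gamma> * t) *\<^sub>R u t)) ` {0..})}"

definition pseudo_stable_set ::
    "(real \<Rightarrow> 'w \<Rightarrow> 'w) \<Rightarrow> (real \<Rightarrow> 'w \<Rightarrow> 'h::{real_inner, banach, second_countable_topology} \<Rightarrow> 'h)
     \<Rightarrow> ('w \<Rightarrow> 'h \<Rightarrow> 'h) \<Rightarrow> ('w \<Rightarrow> real) \<Rightarrow> 'w \<Rightarrow> 'h set" where
  "pseudo_stable_set \<theta> U G \<gamma> \<omega> = {u0. the_solution \<theta> U G \<omega> u0 \<in> C_plus (\<gamma> \<omega>)}"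

end

theory Submission
  imports Defs
begin

text \<open>
  Fix \<open>\<omega>\<close> and write \<open>V t s\<close> for the evolution operator and \<open>J \<tau>\<close> for the unstable projection at
  time \<open>\<tau>\<close> followed by the transport within the unstable spaces back to time \<open>0\<close>. For \<open>\<xi>\<close> in the
  stable space at time \<open>0\<close>, the Lyapunov--Perron operator sends \<open>u\<close> to
  \<open>V t 0 (\<xi> - \<integral>\<^sub>0\<^sup>\<infinity> J \<tau> (G \<tau> (u \<tau>)) d\<tau>) + \<integral>\<^sub>0\<^sup>t V t \<tau> (G \<tau> (u \<tau>)) d\<tau>\<close>. The two exponential estimates and
  the bound on \<open>\<rho>\<close> make it a contraction with constant \<open>1/2\<close> in the weighted norm
  \<open>sup e\<^sup>-\<^sup>\<gamma>\<^sup>t \<parallel>u t\<parallel>\<close>. Every fixed point is a mild solution. Conversely, applying \<open>J t\<close> to a mild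
  solution \<open>u\<close> of growth \<open>e\<^sup>\<gamma>\<^sup>t\<close> and letting \<open>t \<rightarrow> \<infinity>\<close> (temperedness of \<open>K\<close> gives \<open>J t (u t) \<rightarrow> 0\<close>)
  yields \<open>J 0 (u 0) = - \<integral>\<^sub>0\<^sup>\<infinity> J \<tau> (G \<tau> (u \<tau>)) d\<tau>\<close>, so \<open>u\<close> is a fixed point. Hence the stable set is the
  graph of \<open>\<xi> \<mapsto> - \<integral>\<^sub>0\<^sup>\<infinity> J \<tau> (G \<tau> (u\<^sub>\<xi> \<tau>)) d\<tau>\<close>. For arbitrary initial values, a mild solution exists
  and is unique by the same contraction scheme with a faster growing weight, the operators
  \<open>V t s\<close> being locally uniformly bounded by the uniform boundedness principle.
\<close>

subsection \<open>Integrals, uniform boundedness and weighted contractions\<close>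

lemma set_integral_norm_le:
  fixes f :: "'a \<Rightarrow> 'b::{banach, second_countable_topology}" and g :: "'a \<Rightarrow> real"
  assumes g: "set_integrable M A g" and f: "set_borel_measurable M A f"
    and le: "\<And>x. x \<in> A \<Longrightarrow> norm (f x) \<le> g x"
  shows "set_integrable M A f" "norm (LINT x:A|M. f x) \<le> (LINT x:A|M. g x)"
proof -
  show i: "set_integrable M A f"
    by (rule set_integrable_bound[OF g f]) (auto intro!: AE_I2 order_trans[OF le])
  have "norm (LINT x:A|M. f x) \<le> (LINT x:A|M. norm (f x))"
    by (rule set_integral_norm_bound[OF i])
  also have "\<dots> \<le> (LINT x:A|M. g x)"
    by (rule set_integral_mono[OF set_integrable_norm[OF i] g le])
  finally show "norm (LINT x:A|M. f x) \<le> (LINT x:A|M. g x)" .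
qed

lemma exp_integral_atLeast:
  fixes c t :: real
  assumes c: "0 < c"
  shows "set_integrable lborel {t..} (\<lambda>\<tau>. exp (- c * \<tau>))"
    and "(LINT \<tau>:{t..}|lborel. exp (- c * \<tau>)) = exp (- c * t) / c"
proof -
  have a: "((\<lambda>\<tau>. exp (- c * \<tau>)) has_integral exp (- c * t) / c) {t..}"
    by (rule has_integral_exp_minus_to_infinity[OF c])
  have b: "(\<lambda>\<tau>. exp (- c * \<tau>)) absolutely_integrable_on {t..}"
    by (rule nonnegative_absolutely_integrable_1) (use a in \<open>auto simp: integrable_on_def\<close>)
  then show i: "set_integrable lborel {t..} (\<lambda>\<tau>. exp (- c * \<tau>))"
    \<comment> \<open>The gauge integral lives on the completed Lebesgue measure; for a Borel
      integrand integrability passes down to \<open>lborel\<close>.\<close>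
    unfolding set_integrable_def by (subst integrable_completion[symmetric]) auto
  show "(LINT \<tau>:{t..}|lborel. exp (- c * \<tau>)) = exp (- c * t) / c"
    using set_borel_integral_eq_integral(2)[OF i] a by (simp add: integral_unique)
qed

lemma exp_integral_atLeastAtMost:
  fixes c s t :: real
  assumes "c \<noteq> 0" "s \<le> t"
  shows "(LINT \<tau>:{s..t}|lborel. exp (c * \<tau>)) = (exp (c * t) - exp (c * s)) / c"
proof -
  have "(LINT \<tau>:{s..t}|lborel. exp (c * \<tau>)) = exp (c * t) / c - exp (c * s) / c"
    unfolding set_lebesgue_integral_def
  proof (rule integral_FTC_atLeastAtMost[OF assms(2)])
    show "((\<lambda>\<tau>. exp (c * \<tau>) / c) has_vector_derivative exp (c * x)) (at x within {s..t})" for x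
      using assms(1) by (auto intro!: derivative_eq_intros simp flip: has_real_derivative_iff_has_vector_derivative)
  qed (intro continuous_intros)
  then show ?thesis by (simp add: diff_divide_distrib)
qed

text \<open>Replace \<open>f\<close> by simple functions: on each of their level sets the
  composition is a single section of \<open>g\<close>, hence measurable, and continuity in the
  second argument carries measurability to the limit.\<close>

lemma borel_measurable_caratheodory:
  fixes f :: "'a \<Rightarrow> 'b::{metric_space, second_countable_topology}"
    and g :: "'a \<Rightarrow> 'b \<Rightarrow> 'c::metric_space"
  assumes f: "f \<in> borel_measurable M"
    and g: "\<And>x. (\<lambda>a. g a x) \<in> borel_measurable M"
    and cont: "\<And>a. a \<in> space M \<Longrightarrow> continuous_on UNIV (g a)"
  shows "(\<lambda>a. g a (f a)) \<in> borel_measurable M"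
proof -
  obtain s where s: "\<And>i. simple_function M (s i)"
    and lim: "\<And>a. a \<in> space M \<Longrightarrow> (\<lambda>i. s i a) \<longlonglongrightarrow> f a"
    using borel_measurable_implies_sequence_metric[OF f, of undefined] by metis
  have "(\<lambda>a. g a (s i a)) \<in> borel_measurable M" for i
  proof (rule measurable_compose_countable'[where I = "s i ` space M" and f = "\<lambda>x a. g a x"])
    show "countable (s i ` space M)"
      using s by (auto simp: simple_function_def intro: countable_finite)
    show "s i \<in> measurable M (count_space (s i ` space M))"
      using s by (auto simp: measurable_count_space_eq2 simple_function_def)
  qed (rule g)
  moreover have "(\<lambda>i. g a (s i a)) \<longlonglongrightarrow> g a (f a)" if "a \<in> space M" for a
    using cont[OF that] lim[OF that] by (auto simp: continuous_on_eq_continuous_at intro: isCont_tendsto_compose)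
  ultimately show ?thesis by (rule borel_measurable_LIMSEQ_metric)
qed

text \<open>Banach-Steinhaus by Baire category: the closed sets on which the whole family is bounded
  by \<open>n\<close> cover the space, so one of them contains a ball, and differences of points of
  that ball reach every direction.\<close>

lemma uniform_boundedness:
  fixes T :: "'k \<Rightarrow> 'a::banach \<Rightarrow> 'b::real_normed_vector"
  assumes lin: "\<And>k. k \<in> K \<Longrightarrow> bounded_linear (T k)"
    and bdd: "\<And>x. \<exists>B. \<forall>k\<in>K. norm (T k x) \<le> B"
  shows "\<exists>C. \<forall>k\<in>K. \<forall>x. norm (T k x) \<le> C * norm x"
proof -
  define A where "A n = {x. \<forall>k\<in>K. norm (T k x) \<le> real n}" for n
  have cl: "closed (A n)" for n
  proof -
    have "A n = (\<Inter>k\<in>K. {x. norm (T k x) \<le> real n})" by (auto simp: A_def)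
    also have "closed \<dots>"
      by (intro closed_INT ballI closed_Collect_le continuous_intros)
        (auto intro!: linear_continuous_on lin)
    finally show ?thesis .
  qed
  have "x \<in> (\<Union>n. A n)" for x
  proof -
    obtain B where "\<forall>k\<in>K. norm (T k x) \<le> B" using bdd by blast
    moreover obtain n where "B \<le> real n" using real_arch_simple by blast
    ultimately have "x \<in> A n" by (force simp: A_def)
    then show ?thesis by blast
  qed
  then have un: "(\<Union>n. A n) = UNIV" by blast
  have "\<exists>n. interior (A n) \<noteq> {}"
  proof (rule ccontr)
    assume "\<nexists>n. interior (A n) \<noteq> {}"
    then have "euclidean interior_of (\<Union>n. A n) = {}"
      using cl by (intro Baire_category_alt) (auto simp: completely_metrizable_space_euclidean)
    then show False by (simp add: un)
  qed
  then obtain n x0 where "x0 \<in> interior (A n)" by blast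
  then obtain r where r: "0 < r" "cball x0 r \<subseteq> A n"
    by (meson mem_interior_cball)
  have "norm (T k x) \<le> (2 * real n / r) * norm x" if k: "k \<in> K" for k x
  proof (cases "x = 0")
    case True
    then show ?thesis using linear_0[OF bounded_linear.linear[OF lin[OF k]]] by simp
  next
    case False
    interpret bounded_linear "T k" by (rule lin[OF k])
    \<comment> \<open>The vector \<open>x\<close> is rescaled to length \<open>r\<close>, so that
      \<open>x0 + y\<close> stays in the ball; \<open>T k y\<close> is then a difference of two
      values of norm at most \<open>n\<close>.\<close>
    define y where "y = (r / norm x) *\<^sub>R x"
    have "x0 + y \<in> cball x0 r" "x0 \<in> cball x0 r" using r False by (auto simp: y_def dist_norm)
    then have "x0 + y \<in> A n" "x0 \<in> A n" using r(2) by blast+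
    then have "norm (T k (x0 + y)) \<le> n" "norm (T k x0) \<le> n" using k by (auto simp: A_def)
    moreover have "T k y = T k (x0 + y) - T k x0" by (simp add: add)
    ultimately have "norm (T k y) \<le> 2 * real n"
      by (metis (no_types, opaque_lifting) add_mono mult_2 norm_triangle_ineq4 order_trans)
    moreover have "norm (T k y) = r / norm x * norm (T k x)" using r by (simp add: y_def scaleR)
    ultimately show ?thesis using r False by (simp add: field_simps)
  qed
  then show ?thesis by blast
qed

text \<open>The least admissible constant \<open>c\<close> in \<open>d \<le> c * w\<close> satisfies \<open>c \<le> a + c / 2\<close>.\<close>
lemma weighted_absorb:
  fixes d w :: "'a \<Rightarrow> real"
  assumes w: "\<And>t. t \<in> I \<Longrightarrow> 0 < w t" and d: "\<And>t. t \<in> I \<Longrightarrow> 0 \<le> d t"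
    and fin: "\<And>t. t \<in> I \<Longrightarrow> d t \<le> C * w t"
    and step: "\<And>c t. 0 \<le> c \<Longrightarrow> (\<And>t. t \<in> I \<Longrightarrow> d t \<le> c * w t) \<Longrightarrow> t \<in> I \<Longrightarrow> d t \<le> (a + c / 2) * w t"
    and t: "t \<in> I"
  shows "d t \<le> 2 * a * w t"
proof -
  define c where "c = (SUP t\<in>I. d t / w t)"
  have bdd: "bdd_above ((\<lambda>t. d t / w t) ` I)"
    using w fin by (auto intro!: bdd_aboveI[where M=C] simp: divide_le_eq)
  have le: "d s / w s \<le> c" if "s \<in> I" for s
    unfolding c_def using that bdd by (rule cSUP_upper)
  have "0 \<le> d t / w t" using d[OF t] w[OF t] by simp
  with le[OF t] have c: "0 \<le> c" by linarith
  have "d s / w s \<le> a + c / 2" if s: "s \<in> I" for s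
    using step[OF c _ s] le w s by (auto simp: divide_le_eq)
  then have "c \<le> a + c / 2"
    unfolding c_def using t by (intro cSUP_least) auto
  with le[OF t] have "d t / w t \<le> 2 * a" by linarith
  then show ?thesis using w[OF t] by (simp add: divide_le_eq)
qed

text \<open>Picard iteration from the zero function: consecutive iterates differ by at most
  \<open>(1/2) ^ n * K * w t\<close>, so they converge, uniformly where \<open>w\<close> is bounded.
  Pointwise bounds by a weight that need not be continuous cover both the exponential weight of the
  Lyapunov-Perron equation and the step-like one used for arbitrary initial values.\<close>

lemma weighted_fixed_point:
  fixes \<Phi> :: "(real \<Rightarrow> 'h::banach) \<Rightarrow> real \<Rightarrow> 'h" and w :: "real \<Rightarrow> real"
  assumes w: "\<And>t. 0 \<le> t \<Longrightarrow> 0 < w t"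
    and w_bdd: "\<And>T. \<exists>B. \<forall>t\<in>{0..T}. w t \<le> B"
    and cont: "\<And>u C. continuous_on {0..} u \<Longrightarrow> (\<And>t. 0 \<le> t \<Longrightarrow> norm (u t) \<le> C * w t)
        \<Longrightarrow> continuous_on {0..} (\<Phi> u)"
    and contr: "\<And>u v C c t. continuous_on {0..} u \<Longrightarrow> continuous_on {0..} v
        \<Longrightarrow> (\<And>t. 0 \<le> t \<Longrightarrow> norm (u t) \<le> C * w t) \<Longrightarrow> (\<And>t. 0 \<le> t \<Longrightarrow> norm (v t) \<le> C * w t)
        \<Longrightarrow> 0 \<le> c \<Longrightarrow> (\<And>t. 0 \<le> t \<Longrightarrow> norm (u t - v t) \<le> c * w t)
        \<Longrightarrow> 0 \<le> t \<Longrightarrow> norm (\<Phi> u t - \<Phi> v t) \<le> c / 2 * w t"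
    and start: "\<And>t. 0 \<le> t \<Longrightarrow> norm (\<Phi> (\<lambda>_. 0) t) \<le> K * w t"
  shows "\<exists>u C. continuous_on {0..} u \<and> (\<forall>t\<ge>0. norm (u t) \<le> C * w t) \<and> (\<forall>t\<ge>0. \<Phi> u t = u t)"
proof -
  define U where "U n = (\<Phi> ^^ n) (\<lambda>_. 0)" for n
  have U_Suc: "U (Suc n) = \<Phi> (U n)" for n by (simp add: U_def)
  have "0 \<le> norm (\<Phi> (\<lambda>_. 0) 0)" by simp
  also have "\<dots> \<le> K * w 0" by (rule start) simp
  finally have K: "0 \<le> K" using w[of 0] by (simp add: zero_le_mult_iff)
  have inv: "continuous_on {0..} (U n) \<and> (\<forall>t\<ge>0. norm (U n t) \<le> 2 * K * w t)" for n
  proof (induction n)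
    case 0
    then show ?case using K w by (simp add: U_def less_imp_le)
  next
    case (Suc n)
    \<comment> \<open>The ball of radius \<open>2 * K\<close> is invariant: contraction contributes
      \<open>K\<close> and the image of zero contributes another \<open>K\<close>.\<close>
    have "norm (\<Phi> (U n) t - \<Phi> (\<lambda>_. 0) t) \<le> 2 * K / 2 * w t" if t: "0 \<le> t" for t
      by (rule contr[where C="2 * K"]) (use Suc K t w in \<open>auto simp: less_imp_le\<close>)
    then have "norm (\<Phi> (U n) t) \<le> 2 * K * w t" if t: "0 \<le> t" for t
      using t start[OF t] norm_triangle_sub[of "\<Phi> (U n) t" "\<Phi> (\<lambda>_. 0) t"] by fastforce
    moreover have "continuous_on {0..} (\<Phi> (U n))"
      by (rule cont) (use Suc in auto)
    ultimately show ?case by (simp add: U_Suc)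
  qed
  have diff: "\<forall>t\<ge>0. norm (U (Suc n) t - U n t) \<le> (1/2) ^ n * K * w t" for n
  proof (induction n)
    case 0
    then show ?case using start by (simp add: U_def)
  next
    case (Suc n)
    have "norm (\<Phi> (U (Suc n)) t - \<Phi> (U n) t) \<le> ((1/2) ^ n * K) / 2 * w t" if "0 \<le> t" for t
      by (rule contr[where C="2 * K"]) (use Suc K inv that in auto)
    then show ?case by (simp add: U_Suc)
  qed
  have tail: "norm (U (n + k) t - U n t) \<le> 2 * (1/2) ^ n * K * w t" if t: "0 \<le> t" for n k t
  proof -
    \<comment> \<open>The exact geometric partial sum, rather than its limit \<open>2\<close>, is
      what makes the induction close.\<close>
    have "norm (U (n + k) t - U n t) \<le> (2 - 2 * (1/2) ^ k) * (1/2) ^ n * K * w t"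
    proof (induction k)
      case (Suc k)
      have "norm (U (n + Suc k) t - U n t) \<le> norm (U (Suc (n + k)) t - U (n + k) t) + norm (U (n + k) t - U n t)"
        using norm_triangle_ineq[of "U (Suc (n + k)) t - U (n + k) t" "U (n + k) t - U n t"] by simp
      also have "\<dots> \<le> (1/2) ^ (n + k) * K * w t + (2 - 2 * (1/2) ^ k) * (1/2) ^ n * K * w t"
        using diff t Suc by (intro add_mono) auto
      also have "\<dots> = (2 - 2 * (1/2) ^ Suc k) * (1/2) ^ n * K * w t"
        by (simp add: algebra_simps power_add)
      finally show ?case .
    qed simp
    also have "\<dots> \<le> 2 * (1/2) ^ n * K * w t"
      using K w[OF t] by (intro mult_right_mono) auto
    finally show ?thesis .
  qed
  have geo: "(\<lambda>n. 2 * (1/2::real) ^ n * a) \<longlonglongrightarrow> 0" for a :: real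
    by (rule tendsto_mult_left_zero[OF tendsto_mult_right_zero]) (simp add: LIMSEQ_realpow_zero)
  have "\<exists>l. (\<lambda>n. U n t) \<longlonglongrightarrow> l" if t: "0 \<le> t" for t
  proof -
    have "Cauchy (\<lambda>n. U n t)"
    proof (rule metric_CauchyI)
      fix e :: real assume "0 < e"
      then have "\<forall>\<^sub>F n in sequentially. 2 * (1/2::real) ^ n * (K * w t) < e / 2"
        by (intro order_tendstoD(2)[OF geo]) simp
      then obtain N where N: "2 * (1/2::real) ^ N * (K * w t) < e / 2"
        by (auto simp: eventually_sequentially)
      have "dist (U m t) (U N t) < e / 2" if "m \<ge> N" for m
        using tail[OF t, of N "m - N"] N that by (simp add: dist_norm mult.assoc)
      then show "\<exists>N. \<forall>m\<ge>N. \<forall>n\<ge>N. dist (U m t) (U n t) < e"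
        by (meson dist_triangle_half_l)
    qed
    then show ?thesis by (simp add: Cauchy_convergent_iff convergent_def)
  qed
  then obtain u where u: "\<And>t. 0 \<le> t \<Longrightarrow> (\<lambda>n. U n t) \<longlonglongrightarrow> u t" by metis
  have close: "norm (u t - U n t) \<le> 2 * (1/2) ^ n * K * w t" if t: "0 \<le> t" for t n
  proof (rule LIMSEQ_le_const2)
    show "(\<lambda>k. norm (U (k + n) t - U n t)) \<longlonglongrightarrow> norm (u t - U n t)"
      by (intro tendsto_intros LIMSEQ_ignore_initial_segment u t)
    show "\<exists>N. \<forall>k\<ge>N. norm (U (k + n) t - U n t) \<le> 2 * (1/2) ^ n * K * w t"
      using tail[OF t, of n] by (auto simp: add.commute[of _ n])
  qed
  have cont_T: "continuous_on {0..T} u" for T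
  proof -
    obtain B where B: "\<And>t. t \<in> {0..T} \<Longrightarrow> w t \<le> B" using w_bdd by blast
    have "uniform_limit {0..T} U u sequentially"
    proof (rule uniform_limitI)
      fix e :: real assume e: "0 < e"
      have "\<forall>\<^sub>F n in sequentially. 2 * (1/2::real) ^ n * (K * B) < e"
        using geo[of "K * B"] e by (rule order_tendstoD)
      then show "\<forall>\<^sub>F n in sequentially. \<forall>t\<in>{0..T}. dist (U n t) (u t) < e"
      proof eventually_elim
        case (elim n)
        have "dist (U n t) (u t) < e" if t: "t \<in> {0..T}" for t
        proof -
          have "dist (U n t) (u t) \<le> 2 * (1/2) ^ n * K * w t"
            using close[of t n] t by (simp add: dist_norm norm_minus_commute)
          also have "\<dots> \<le> 2 * (1/2) ^ n * K * B" using B[OF t] K by (intro mult_left_mono) auto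
          finally show ?thesis using elim by (simp add: mult.assoc)
        qed
        then show ?case by blast
      qed
    qed
    then show ?thesis
      by (rule uniform_limit_theorem[rotated])
        (auto intro!: always_eventually continuous_on_subset[OF conjunct1[OF inv]])
  qed
  \<comment> \<open>A convergent sequence of times is bounded, so continuity on the intervals
    \<open>{0..T}\<close> is enough.\<close>
  have cu: "continuous_on {0..} u"
    unfolding continuous_on_sequentially
  proof (intro allI ballI impI, elim conjE)
    fix x :: "nat \<Rightarrow> real" and a
    assume x: "\<forall>n. x n \<in> {0..}" and lim: "a \<in> {0..}" "x \<longlonglongrightarrow> a"
    obtain B where "\<And>n. norm (x n) \<le> B" using convergent_imp_Bseq[of x] lim(2) by (auto simp: convergent_def Bseq_def)
    then have "\<And>n. x n \<in> {0..max a B}" using x by (auto simp: abs_le_iff le_max_iff_disj)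
    with cont_T[of "max a B"] lim show "(u \<circ> x) \<longlonglongrightarrow> u a"
      unfolding continuous_on_sequentially by auto
  qed
  have bu: "norm (u t) \<le> 2 * K * w t" if t: "0 \<le> t" for t
    using close[OF t, of 0] by (simp add: U_def)
  have "\<Phi> u t = u t" if t: "0 \<le> t" for t
  proof -
    have le: "norm (\<Phi> u t - u t) \<le> 2 * (1/2) ^ n * (2 * (K * w t))" for n
    proof -
      have "norm (\<Phi> u t - \<Phi> (U n) t) \<le> (2 * (1/2) ^ n * K) / 2 * w t"
        by (rule contr[where C="2 * K"]) (use cu inv bu K close t in auto)
      moreover have "norm (u t - U (Suc n) t) \<le> 2 * (1/2) ^ Suc n * K * w t" by (rule close[OF t])
      moreover have "norm (\<Phi> u t - u t) \<le> norm (\<Phi> u t - \<Phi> (U n) t) + norm (u t - U (Suc n) t)"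
        unfolding U_Suc by (metis norm_minus_commute norm_triangle_sub diff_add_cancel add_diff_eq norm_triangle_ineq diff_add_eq)
      moreover have "0 \<le> (1/2) ^ n * K * w t" using w[OF t] K by simp
      ultimately show ?thesis by (simp add: algebra_simps)
    qed
    have "norm (\<Phi> u t - u t) \<le> 0"
      by (rule LIMSEQ_le_const[OF geo]) (use le in blast)
    then show ?thesis by simp
  qed
  with cu bu show ?thesis by blast
qed

subsection \<open>Evolution families\<close>

text \<open>The two sets share at most one point, which is Lebesgue null; this allows splitting at a
  time that belongs to both closed intervals.\<close>

lemma set_integral_overlap_Un:
  fixes f :: "real \<Rightarrow> 'b::{banach, second_countable_topology}"
  assumes "set_integrable lborel A f" "set_integrable lborel B f" "A \<inter> B \<subseteq> {t}"
    and "A \<in> sets borel" "B \<in> sets borel"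
  shows "(LINT \<tau>:A \<union> B|lborel. f \<tau>) = (LINT \<tau>:A|lborel. f \<tau>) + (LINT \<tau>:B|lborel. f \<tau>)"
proof (rule set_integral_Un_AE)
  show "AE x in lborel. \<not> (x \<in> A \<and> x \<in> B)"
    using AE_lborel_singleton[of t] by eventually_elim (use assms(3) in auto)
qed (use assms in auto)

lemma set_integral_bounded_linear:
  fixes f :: "'a \<Rightarrow> 'b::{banach, second_countable_topology}"
    and T :: "'b \<Rightarrow> 'c::{banach, second_countable_topology}"
  assumes T: "bounded_linear T" and f: "set_integrable M A f"
  shows "set_integrable M A (\<lambda>x. T (f x))" "(LINT x:A|M. T (f x)) = T (LINT x:A|M. f x)"
proof -
  have eq: "indicator A x *\<^sub>R T (f x) = T (indicator A x *\<^sub>R f x)" for x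
    by (simp add: linear_simps(5)[OF T])
  show "set_integrable M A (\<lambda>x. T (f x))"
    using integrable_bounded_linear[OF T f[unfolded set_integrable_def]]
    unfolding set_integrable_def eq .
  show "(LINT x:A|M. T (f x)) = T (LINT x:A|M. f x)"
    using integral_bounded_linear[OF T f[unfolded set_integrable_def]]
    unfolding set_lebesgue_integral_def eq .
qed

text \<open>Only nonnegative times enter, because the stable set is determined by solutions on the
  forward half-line.\<close>

locale evolution_family =
  fixes V :: "real \<Rightarrow> real \<Rightarrow> 'h \<Rightarrow> 'h::{banach, second_countable_topology}"
  assumes linear_V: "0 \<le> s \<Longrightarrow> s \<le> t \<Longrightarrow> bounded_linear (V t s)"
    and V_refl: "0 \<le> s \<Longrightarrow> V s s x = x"
    and V_comp: "0 \<le> r \<Longrightarrow> r \<le> s \<Longrightarrow> s \<le> t \<Longrightarrow> V t s (V s r x) = V t r x"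
    and V_cont: "continuous_on {(t, s). 0 \<le> s \<and> s \<le> t} (\<lambda>(t, s). V t s x)"
begin

text \<open>The triangle of admissible time pairs up to \<open>T\<close> is compact, so strong
  continuity bounds each orbit, and uniform boundedness gives one constant for all vectors.\<close>

lemma V_bound: "\<exists>C\<ge>0. \<forall>s t x. 0 \<le> s \<longrightarrow> s \<le> t \<longrightarrow> t \<le> T \<longrightarrow> norm (V t s x) \<le> C * norm x"
proof -
  let ?K = "{(t, s). 0 \<le> s \<and> s \<le> t \<and> t \<le> T}"
  have "?K = ({0..T} \<times> {0..T}) \<inter> {p. snd p \<le> fst p}" by auto
  also have "compact \<dots>"
    by (intro compact_Int_closed compact_Times closed_Collect_le continuous_intros) auto
  finally have K: "compact ?K" .
  have "\<exists>C. \<forall>k\<in>?K. \<forall>x. norm ((case k of (t, s) \<Rightarrow> V t s) x) \<le> C * norm x"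
  proof (rule uniform_boundedness)
    show "\<exists>B. \<forall>k\<in>?K. norm ((case k of (t, s) \<Rightarrow> V t s) x) \<le> B" for x
    proof -
      have "continuous_on ?K (\<lambda>(t, s). V t s x)"
        by (rule continuous_on_subset[OF V_cont]) auto
      then have "bounded ((\<lambda>(t, s). V t s x) ` ?K)"
        by (intro compact_imp_bounded compact_continuous_image K)
      then obtain B where "\<forall>y\<in>(\<lambda>(t, s). V t s x) ` ?K. norm y \<le> B" unfolding bounded_iff by blast
      then show ?thesis by (intro exI[of _ B]) (auto split: prod.splits)
    qed
  qed (auto intro: linear_V)
  then obtain C where C: "\<And>s t x. 0 \<le> s \<Longrightarrow> s \<le> t \<Longrightarrow> t \<le> T \<Longrightarrow> norm (V t s x) \<le> C * norm x"
    by auto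
  have "norm (V t s x) \<le> max 0 C * norm x" if "0 \<le> s" "s \<le> t" "t \<le> T" for s t x
    using C[OF that, of x] by (meson max.cobounded2 mult_right_mono norm_ge_zero order_trans)
  then show ?thesis by (intro exI[of _ "max 0 C"]) auto
qed

section \<open>Measurability and continuity of the variation-of-constants integral\<close>

lemma continuous_on_V_left: "continuous_on {0..} (\<lambda>t. V t 0 x)"
proof -
  have "continuous_on {0..} ((\<lambda>(t, s). V t s x) \<circ> (\<lambda>t. (t, 0)))"
    by (intro continuous_on_compose continuous_intros continuous_on_subset[OF V_cont]) auto
  then show ?thesis by (simp add: o_def)
qed

text \<open>Clamping \<open>\<tau>\<close> to \<open>{0..t}\<close> yields an integrand defined for
  all real \<open>\<tau>\<close>, continuous in time and in the vector, to which the Caratheodory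
  argument applies; on the interval itself nothing changes.\<close>

lemma V_measurable:
  assumes f: "f \<in> borel_measurable borel" and t: "0 \<le> t"
  shows "set_borel_measurable lborel {0..t} (\<lambda>\<tau>. V t \<tau> (f \<tau>))"
proof -
  have "(\<lambda>\<tau>. V t (max 0 (min \<tau> t)) (f \<tau>)) \<in> borel_measurable borel"
  proof (rule borel_measurable_caratheodory[OF f])
    fix x
    have "continuous_on UNIV (\<lambda>\<tau>. (t, max 0 (min \<tau> t)))"
      by (intro continuous_intros)
    then have "continuous_on UNIV ((\<lambda>(t, s). V t s x) \<circ> (\<lambda>\<tau>. (t, max 0 (min \<tau> t))))"
      by (rule continuous_on_compose[OF _ continuous_on_subset[OF V_cont]]) (use t in auto)
    then show "(\<lambda>\<tau>. V t (max 0 (min \<tau> t)) x) \<in> borel_measurable borel"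
      by (intro borel_measurable_continuous_onI) (simp add: o_def)
    show "continuous_on UNIV (V t (max 0 (min \<tau> t)))" for \<tau>
      by (rule linear_continuous_on[OF linear_V]) (use t in auto)
  qed
  then have "(\<lambda>\<tau>. indicator {0..t} \<tau> *\<^sub>R V t (max 0 (min \<tau> t)) (f \<tau>)) \<in> borel_measurable lborel"
    by measurable
  also have "(\<lambda>\<tau>. indicator {0..t} \<tau> *\<^sub>R V t (max 0 (min \<tau> t)) (f \<tau>))
      = (\<lambda>\<tau>. indicator {0..t} \<tau> *\<^sub>R V t \<tau> (f \<tau>))"
    by (auto split: split_indicator)
  finally show ?thesis unfolding set_borel_measurable_def .
qed

lemma V_integrable:
  assumes f: "f \<in> borel_measurable borel" and B: "\<And>\<tau>. 0 \<le> \<tau> \<Longrightarrow> \<tau> \<le> t \<Longrightarrow> norm (f \<tau>) \<le> B"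
    and t: "0 \<le> t"
  shows "set_integrable lborel {0..t} (\<lambda>\<tau>. V t \<tau> (f \<tau>))"
proof -
  obtain C where C: "0 \<le> C" "\<And>s x. 0 \<le> s \<Longrightarrow> s \<le> t \<Longrightarrow> norm (V t s x) \<le> C * norm x"
    using V_bound[of t] by auto
  have "set_integrable lborel {0..t} (\<lambda>\<tau>. C * B)"
    by (rule borel_integrable_atLeastAtMost') (rule continuous_on_const)
  moreover have "norm (V t \<tau> (f \<tau>)) \<le> C * B" if "\<tau> \<in> {0..t}" for \<tau>
    using C(2)[of \<tau> "f \<tau>"] mult_left_mono[OF B C(1), of \<tau>] that by fastforce
  ultimately show ?thesis
    by (rule set_integral_norm_le(1)[OF _ V_measurable[OF f t]])
qed

abbreviation duhamel :: "(real \<Rightarrow> 'h) \<Rightarrow> real \<Rightarrow> 'h" where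
  "duhamel f t \<equiv> (LINT \<tau>:{0..t}|lborel. V t \<tau> (f \<tau>))"

lemma duhamel_0: "duhamel f 0 = 0"
  unfolding set_lebesgue_integral_def
  by (rule integral_eq_zero_AE) (use AE_lborel_singleton[of 0] in \<open>eventually_elim, auto\<close>)

text \<open>Dominated convergence along a sequence of upper limits, with the integrands extended by
  zero to one common interval and bounded there by a constant.\<close>

lemma continuous_on_duhamel:
  assumes f: "f \<in> borel_measurable borel"
    and bdd: "\<And>T. \<exists>B. \<forall>\<tau>\<in>{0..T}. norm (f \<tau>) \<le> B"
  shows "continuous_on {0..} (duhamel f)"
  unfolding continuous_on_sequentially
proof (intro allI ballI impI, elim conjE)
  fix x :: "nat \<Rightarrow> real" and a
  assume "\<forall>n. x n \<in> {0..}" and a: "a \<in> {0..}" and lim: "x \<longlonglongrightarrow> a"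
  then have x0: "0 \<le> x n" for n by simp
  obtain T0 where "\<And>n. norm (x n) \<le> T0"
    using convergent_imp_Bseq[of x] lim by (auto simp: convergent_def Bseq_def)
  then have T0: "x n \<le> T0" for n by (simp add: abs_le_iff)
  define T where "T = max a T0"
  have xT: "x n \<le> T" "a \<le> T" for n using T0[of n] by (auto simp: T_def)
  obtain C where C: "0 \<le> C" "\<And>s t x. 0 \<le> s \<Longrightarrow> s \<le> t \<Longrightarrow> t \<le> T \<Longrightarrow> norm (V t s x) \<le> C * norm x"
    using V_bound[of T] by auto
  obtain B where B: "\<And>\<tau>. \<tau> \<in> {0..T} \<Longrightarrow> norm (f \<tau>) \<le> B" using bdd by blast
  have meas: "(\<lambda>\<tau>. indicator {0..t} \<tau> *\<^sub>R V t \<tau> (f \<tau>)) \<in> borel_measurable lborel" if "0 \<le> t" for t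
    using V_measurable[OF f that] unfolding set_borel_measurable_def .
  have "(\<lambda>n. duhamel f (x n)) \<longlonglongrightarrow> duhamel f a"
    unfolding set_lebesgue_integral_def
  proof (rule integral_dominated_convergence[where w = "\<lambda>\<tau>. indicator {0..T} \<tau> *\<^sub>R (C * B)"])
    show "integrable lborel (\<lambda>\<tau>. indicator {0..T} \<tau> *\<^sub>R (C * B))"
      using borel_integrable_atLeastAtMost'[OF continuous_on_const, of 0 T "C * B"] by (simp add: set_integrable_def)
    show "AE \<tau> in lborel. norm (indicator {0..x n} \<tau> *\<^sub>R V (x n) \<tau> (f \<tau>)) \<le> indicator {0..T} \<tau> *\<^sub>R (C * B)" for n
    proof (rule AE_I2)
      fix \<tau>
      show "norm (indicator {0..x n} \<tau> *\<^sub>R V (x n) \<tau> (f \<tau>)) \<le> indicator {0..T} \<tau> *\<^sub>R (C * B)"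
      proof (cases "\<tau> \<in> {0..x n}")
        case True
        then have "\<tau> \<in> {0..T}" using xT(1)[of n] by auto
        moreover have "norm (V (x n) \<tau> (f \<tau>)) \<le> C * norm (f \<tau>)" using True xT(1)[of n] by (intro C) auto
        ultimately show ?thesis using True mult_left_mono[OF B[of \<tau>] C(1)] by simp
      next
        case False
        have "0 \<le> C * B" if "\<tau> \<in> {0..T}" using order_trans[OF norm_ge_zero B[OF that]] C(1) by simp
        then show ?thesis using False by (auto split: split_indicator)
      qed
    qed
    \<comment> \<open>At \<open>\<tau> = a\<close> the indicators may oscillate; this null point is
      left out.\<close>
    show "AE \<tau> in lborel. (\<lambda>n. indicator {0..x n} \<tau> *\<^sub>R V (x n) \<tau> (f \<tau>))
        \<longlonglongrightarrow> indicator {0..a} \<tau> *\<^sub>R V a \<tau> (f \<tau>)"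
      using AE_lborel_singleton[of a]
    proof eventually_elim
      fix \<tau> assume ne: "\<tau> \<noteq> a"
      consider "\<tau> < 0" | "0 \<le> \<tau>" "\<tau> < a" | "a < \<tau>" using ne by linarith
      then show "(\<lambda>n. indicator {0..x n} \<tau> *\<^sub>R V (x n) \<tau> (f \<tau>))
        \<longlonglongrightarrow> indicator {0..a} \<tau> *\<^sub>R V a \<tau> (f \<tau>)"
      proof cases
        case 2
        have "\<forall>\<^sub>F n in sequentially. \<tau> < x n" by (rule order_tendstoD(1)[OF lim 2(2)])
        then have ev: "\<forall>\<^sub>F n in sequentially. V (x n) \<tau> (f \<tau>) = indicator {0..x n} \<tau> *\<^sub>R V (x n) \<tau> (f \<tau>)"
          by eventually_elim (use 2 in auto)
        \<comment> \<open>The maximum keeps every pair inside the triangle where \<open>V\<close> is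
          continuous, and it equals \<open>x n\<close> for all large \<open>n\<close>.\<close>
        have "(\<lambda>n. (max \<tau> (x n), \<tau>)) \<longlonglongrightarrow> (max \<tau> a, \<tau>)" by (intro tendsto_intros lim)
        then have "(\<lambda>n. (\<lambda>(t, s). V t s (f \<tau>)) (max \<tau> (x n), \<tau>)) \<longlonglongrightarrow> (\<lambda>(t, s). V t s (f \<tau>)) (max \<tau> a, \<tau>)"
          by (rule continuous_on_tendsto_compose[OF V_cont]) (use 2 in auto)
        moreover have "\<forall>\<^sub>F n in sequentially. (\<lambda>(t, s). V t s (f \<tau>)) (max \<tau> (x n), \<tau>) = V (x n) \<tau> (f \<tau>)"
          using \<open>\<forall>\<^sub>F n in sequentially. \<tau> < x n\<close> by eventually_elim simp
        ultimately have "(\<lambda>n. V (x n) \<tau> (f \<tau>)) \<longlonglongrightarrow> V a \<tau> (f \<tau>)"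
          using 2 by (auto simp: max_def intro: Lim_transform_eventually)
        then have "(\<lambda>n. indicator {0..x n} \<tau> *\<^sub>R V (x n) \<tau> (f \<tau>)) \<longlonglongrightarrow> V a \<tau> (f \<tau>)"
          using ev by (rule Lim_transform_eventually)
        then show ?thesis using 2 by simp
      next
        case 3
        have "\<forall>\<^sub>F n in sequentially. x n < \<tau>" by (rule order_tendstoD(2)[OF lim 3])
        then have "\<forall>\<^sub>F n in sequentially. 0 = indicator {0..x n} \<tau> *\<^sub>R V (x n) \<tau> (f \<tau>)"
          by eventually_elim auto
        with tendsto_const have "(\<lambda>n. indicator {0..x n} \<tau> *\<^sub>R V (x n) \<tau> (f \<tau>)) \<longlonglongrightarrow> 0"
          by (rule Lim_transform_eventually)
        then show ?thesis using 3 by simp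
      qed auto
    qed
  qed (use meas x0 a in auto)
  then show "(duhamel f \<circ> x) \<longlonglongrightarrow> duhamel f a" by (simp add: o_def)
qed

text \<open>Split the integral at \<open>s\<close>; on the earlier piece \<open>V t \<tau>\<close>
  factors through time \<open>s\<close>, and the bounded operator \<open>V t s\<close> comes out of
  the integral.\<close>

lemma duhamel_shift:
  assumes f: "f \<in> borel_measurable borel"
    and bdd: "\<And>T. \<exists>B. \<forall>\<tau>\<in>{0..T}. norm (f \<tau>) \<le> B"
    and st: "0 \<le> s" "s \<le> t"
  shows "set_integrable lborel {s..t} (\<lambda>\<tau>. V t \<tau> (f \<tau>))"
    and "duhamel f t = V t s (duhamel f s) + (LINT \<tau>:{s..t}|lborel. V t \<tau> (f \<tau>))"
proof -
  obtain B where B: "\<And>\<tau>. \<tau> \<in> {0..t} \<Longrightarrow> norm (f \<tau>) \<le> B" using bdd by blast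
  have it: "set_integrable lborel {0..t} (\<lambda>\<tau>. V t \<tau> (f \<tau>))"
    by (rule V_integrable[OF f, where B = B]) (use B st in auto)
  have is0: "set_integrable lborel {0..s} (\<lambda>\<tau>. V s \<tau> (f \<tau>))"
    by (rule V_integrable[OF f, where B = B]) (use B st in auto)
  show i1: "set_integrable lborel {s..t} (\<lambda>\<tau>. V t \<tau> (f \<tau>))"
    by (rule set_integrable_subset[OF it]) (use st in auto)
  have i2: "set_integrable lborel {0..s} (\<lambda>\<tau>. V t \<tau> (f \<tau>))"
    by (rule set_integrable_subset[OF it]) (use st in auto)
  have "duhamel f t = (LINT \<tau>:{0..s} \<union> {s..t}|lborel. V t \<tau> (f \<tau>))"
    using st by (simp add: ivl_disj_un_two_touch)
  also have "\<dots> = (LINT \<tau>:{0..s}|lborel. V t \<tau> (f \<tau>)) + (LINT \<tau>:{s..t}|lborel. V t \<tau> (f \<tau>))"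
    by (rule set_integral_overlap_Un[OF i2 i1, of s]) auto
  also have "(LINT \<tau>:{0..s}|lborel. V t \<tau> (f \<tau>)) = (LINT \<tau>:{0..s}|lborel. V t s (V s \<tau> (f \<tau>)))"
    by (rule set_lebesgue_integral_cong) (use st V_comp in auto)
  also have "\<dots> = V t s (duhamel f s)"
    by (rule set_integral_bounded_linear(2)[OF linear_V is0]) (use st in auto)
  finally show "duhamel f t = V t s (duhamel f s) + (LINT \<tau>:{s..t}|lborel. V t \<tau> (f \<tau>))" .
qed

end

subsection \<open>Mild solutions\<close>

text \<open>The deterministic problem obtained by fixing a sample point: \<open>g\<close> plays the
  role of the cut-off nonlinearity along its orbit.\<close>

locale semilinear_evolution = evolution_family V
  for V :: "real \<Rightarrow> real \<Rightarrow> 'h \<Rightarrow> 'h::{banach, second_countable_topology}" +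
  fixes g :: "real \<Rightarrow> 'h \<Rightarrow> 'h" and L :: real
  assumes g_measurable: "(\<lambda>\<tau>. g \<tau> x) \<in> borel_measurable borel"
    and g_0: "g \<tau> 0 = 0"
    and g_lipschitz: "norm (g \<tau> x - g \<tau> y) \<le> L * norm (x - y)"
    and L_nonneg: "0 \<le> L"
begin

text \<open>Freezing \<open>u\<close> at negative times makes the superposition Borel measurable on the whole line.\<close>
definition superpos :: "(real \<Rightarrow> 'h) \<Rightarrow> real \<Rightarrow> 'h" where
  "superpos u \<tau> = g \<tau> (u (max 0 \<tau>))"

lemma superpos_eq [simp]: "0 \<le> \<tau> \<Longrightarrow> superpos u \<tau> = g \<tau> (u \<tau>)"
  by (simp add: superpos_def)

section \<open>Superposition along a continuous path and the mild equation\<close>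

lemma g_bound: "norm (g \<tau> x) \<le> L * norm x"
  using g_lipschitz[of \<tau> x 0] by (simp add: g_0)

lemma superpos_measurable:
  assumes "continuous_on {0..} u"
  shows "superpos u \<in> borel_measurable borel"
  unfolding superpos_def
proof (rule borel_measurable_caratheodory[OF _ g_measurable])
  show "(\<lambda>\<tau>. u (max 0 \<tau>)) \<in> borel_measurable borel"
    by (intro borel_measurable_continuous_onI continuous_on_compose2[OF assms] continuous_intros) auto
  show "continuous_on UNIV (g \<tau>)" for \<tau>
    by (rule lipschitz_on_continuous_on[of L]) (auto simp: lipschitz_on_def dist_norm g_lipschitz L_nonneg)
qed

lemma superpos_bounded:
  assumes "continuous_on {0..} u"
  shows "\<exists>B. \<forall>\<tau>\<in>{0..T}. norm (superpos u \<tau>) \<le> B"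
proof -
  have "bounded (u ` {0..T})"
    by (intro compact_imp_bounded compact_continuous_image continuous_on_subset[OF assms]) auto
  then obtain b where b: "\<And>\<tau>. \<tau> \<in> {0..T} \<Longrightarrow> norm (u \<tau>) \<le> b"
    unfolding bounded_iff by blast
  have "norm (superpos u \<tau>) \<le> L * b" if "\<tau> \<in> {0..T}" for \<tau>
    using order_trans[OF g_bound mult_left_mono[OF b[OF that] L_nonneg]] that by simp
  then show ?thesis by blast
qed

text \<open>Shaped like \<open>mild_solution\<close>, so that the two agree once the evolution
  operator of the random system is unfolded.\<close>

definition mild :: "(real \<Rightarrow> 'h) \<Rightarrow> bool" where
  "mild u \<longleftrightarrow>
     continuous_on {0..} u
   \<and> (\<forall>s t. 0 \<le> s \<longrightarrow> s \<le> t \<longrightarrow>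
        set_integrable lborel {s..t} (\<lambda>\<tau>. V t \<tau> (g \<tau> (u \<tau>)))
      \<and> u t = V t s (u s) + (LINT \<tau>:{s..t}|lborel. V t \<tau> (g \<tau> (u \<tau>))))"

lemma duhamel_superpos:
  "duhamel (superpos u) t = (LINT \<tau>:{0..t}|lborel. V t \<tau> (g \<tau> (u \<tau>)))"
  by (rule set_lebesgue_integral_cong) auto

lemma superpos_integrable:
  assumes "continuous_on {0..} u" "0 \<le> t"
  shows "set_integrable lborel {0..t} (\<lambda>\<tau>. V t \<tau> (superpos u \<tau>))"
  by (rule duhamel_shift(1)[OF superpos_measurable superpos_bounded]) (use assms in auto)

text \<open>By \<open>duhamel_shift\<close> and the composition law, the equation started at time
  \<open>0\<close> already contains the one started at any later time.\<close>

lemma mild_iff: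
  assumes u: "continuous_on {0..} u"
  shows "mild u \<longleftrightarrow> (\<forall>t\<ge>0. u t = V t 0 (u 0) + duhamel (superpos u) t)"
proof
  assume "mild u"
  then show "\<forall>t\<ge>0. u t = V t 0 (u 0) + duhamel (superpos u) t"
    unfolding duhamel_superpos mild_def by blast
next
  assume eq: "\<forall>t\<ge>0. u t = V t 0 (u 0) + duhamel (superpos u) t"
  show "mild u" unfolding mild_def
  proof (intro conjI allI impI u)
    fix s t :: real assume st: "0 \<le> s" "s \<le> t"
    note sh = duhamel_shift[OF superpos_measurable[OF u] superpos_bounded[OF u] st]
    have "set_integrable lborel {s..t} (\<lambda>\<tau>. V t \<tau> (g \<tau> (u \<tau>)))
        \<longleftrightarrow> set_integrable lborel {s..t} (\<lambda>\<tau>. V t \<tau> (superpos u \<tau>))"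
      by (rule set_integrable_cong) (use st in auto)
    with sh(1) show "set_integrable lborel {s..t} (\<lambda>\<tau>. V t \<tau> (g \<tau> (u \<tau>)))" by simp
    have "(LINT \<tau>:{s..t}|lborel. V t \<tau> (g \<tau> (u \<tau>))) = (LINT \<tau>:{s..t}|lborel. V t \<tau> (superpos u \<tau>))"
      by (rule set_lebesgue_integral_cong) (use st in auto)
    moreover have "u t = V t 0 (u 0) + duhamel (superpos u) t"
      by (rule eq[rule_format, OF order_trans[OF st]])
    moreover have "u s = V s 0 (u 0) + duhamel (superpos u) s"
      by (rule eq[rule_format, OF st(1)])
    moreover have "V t s (V s 0 (u 0) + duhamel (superpos u) s) = V t 0 (u 0) + V t s (duhamel (superpos u) s)"
      using linear_simps(1)[OF linear_V[OF st]] V_comp[of 0 s t] st by simp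
    ultimately show "u t = V t s (u s) + (LINT \<tau>:{s..t}|lborel. V t \<tau> (g \<tau> (u \<tau>)))"
      by (simp only: sh(2) add.assoc)
  qed
qed

text \<open>Integrating the weight \<open>exp (\<mu> * \<tau>)\<close> gains a factor
  \<open>1 / \<mu>\<close>; a large rate therefore turns the integral operator into a contraction
  without any smallness of \<open>L\<close>.\<close>

lemma duhamel_superpos_diff:
  assumes u: "continuous_on {0..} u" and v: "continuous_on {0..} v"
    and t: "0 \<le> t" and \<mu>: "0 < \<mu>" and c: "0 \<le> c" and C: "0 \<le> C"
    and V: "\<And>\<tau> x. 0 \<le> \<tau> \<Longrightarrow> \<tau> \<le> t \<Longrightarrow> norm (V t \<tau> x) \<le> C * norm x"
    and le: "\<And>\<tau>. 0 \<le> \<tau> \<Longrightarrow> \<tau> \<le> t \<Longrightarrow> norm (u \<tau> - v \<tau>) \<le> c * exp (\<mu> * \<tau>)"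
  shows "norm (duhamel (superpos u) t - duhamel (superpos v) t) \<le> C * L * c / \<mu> * exp (\<mu> * t)"
proof -
  let ?d = "\<lambda>\<tau>. V t \<tau> (superpos u \<tau>) - V t \<tau> (superpos v \<tau>)"
  have iu: "set_integrable lborel {0..t} (\<lambda>\<tau>. V t \<tau> (superpos u \<tau>))"
    and iv: "set_integrable lborel {0..t} (\<lambda>\<tau>. V t \<tau> (superpos v \<tau>))"
    by (rule superpos_integrable; fact)+
  have id: "set_integrable lborel {0..t} ?d"
    by (rule set_integral_diff(1)[OF iu iv])
  have ie: "set_integrable lborel {0..t} (\<lambda>\<tau>. C * L * c * exp (\<mu> * \<tau>))"
    by (intro borel_integrable_atLeastAtMost' continuous_intros)
  have bd: "norm (?d \<tau>) \<le> C * L * c * exp (\<mu> * \<tau>)" if "\<tau> \<in> {0..t}" for \<tau>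
  proof -
    have "?d \<tau> = V t \<tau> (g \<tau> (u \<tau>) - g \<tau> (v \<tau>))"
      using linear_simps(2)[OF linear_V[of \<tau> t]] that by auto
    then have "norm (?d \<tau>) \<le> C * norm (g \<tau> (u \<tau>) - g \<tau> (v \<tau>))" using V that by auto
    also have "\<dots> \<le> C * (L * (c * exp (\<mu> * \<tau>)))"
      using le[of \<tau>] that
      by (intro mult_left_mono[OF order_trans[OF g_lipschitz mult_left_mono]] C L_nonneg) auto
    finally show ?thesis by (simp add: mult.assoc)
  qed
  have "duhamel (superpos u) t - duhamel (superpos v) t = (LINT \<tau>:{0..t}|lborel. ?d \<tau>)"
    by (simp add: set_integral_diff(2)[OF iu iv])
  also have "norm \<dots> \<le> (LINT \<tau>:{0..t}|lborel. C * L * c * exp (\<mu> * \<tau>))"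
    by (rule set_integral_norm_le(2)[OF ie _ bd])
      (use id in \<open>auto simp: set_integrable_def set_borel_measurable_def\<close>)
  also have "\<dots> = C * L * c * ((exp (\<mu> * t) - 1) / \<mu>)"
    using exp_integral_atLeastAtMost[of \<mu> 0 t] \<mu> t by simp
  also have "\<dots> \<le> C * L * c * (exp (\<mu> * t) / \<mu>)"
    using C L_nonneg c \<mu> by (intro mult_left_mono divide_right_mono) auto
  finally show ?thesis by simp
qed

text \<open>Equal initial values cancel the linear term, so the weighted difference is at most half
  of itself and \<open>weighted_absorb\<close> applies with \<open>a = 0\<close>.\<close>

lemma mild_unique:
  assumes u: "mild u" and v: "mild v" and eq: "u 0 = v 0" and T: "0 \<le> T"
  shows "u T = v T"
proof -
  have cu: "continuous_on {0..} u" and cv: "continuous_on {0..} v"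
    using u v by (auto simp: mild_def)
  obtain C where C: "0 \<le> C" "\<And>s t x. 0 \<le> s \<Longrightarrow> s \<le> t \<Longrightarrow> t \<le> T \<Longrightarrow> norm (V t s x) \<le> C * norm x"
    using V_bound[of T] by auto
  \<comment> \<open>Twice \<open>C * L\<close> gives the contraction factor \<open>1/2\<close>; the
    added \<open>1\<close> keeps the rate positive when \<open>C * L\<close> vanishes.\<close>
  define \<mu> where "\<mu> = 2 * C * L + 1"
  have "0 \<le> C * L" using C(1) L_nonneg by simp
  then have \<mu>: "0 < \<mu>" "C * L / \<mu> \<le> 1 / 2" by (simp_all add: \<mu>_def divide_le_eq)
  have "continuous_on {0..T} (\<lambda>t. u t - v t)"
    by (rule continuous_on_subset[OF continuous_on_diff[OF cu cv]]) auto
  then have "bounded ((\<lambda>t. u t - v t) ` {0..T})"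
    by (intro compact_imp_bounded compact_continuous_image compact_Icc)
  then obtain b where b: "\<And>t. t \<in> {0..T} \<Longrightarrow> norm (u t - v t) \<le> b"
    unfolding bounded_iff by blast
  have "norm (u T - v T) \<le> 2 * 0 * exp (\<mu> * T)"
  proof (rule weighted_absorb[where I = "{0..T}" and C = b and d = "\<lambda>t. norm (u t - v t)"])
    fix t assume t: "t \<in> {0..T}"
    have "0 \<le> b" using order_trans[OF norm_ge_zero b[OF t]] .
    then have "b * 1 \<le> b * exp (\<mu> * t)" using t \<mu> by (intro mult_left_mono) auto
    then show "norm (u t - v t) \<le> b * exp (\<mu> * t)" using b[OF t] by simp
  next
    fix c t assume c: "0 \<le> c" and le: "\<And>t. t \<in> {0..T} \<Longrightarrow> norm (u t - v t) \<le> c * exp (\<mu> * t)"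
      and t: "t \<in> {0..T}"
    have "u t - v t = duhamel (superpos u) t - duhamel (superpos v) t"
    proof -
      have "u t = V t 0 (u 0) + duhamel (superpos u) t" using u t mild_iff[OF cu] by (meson atLeastAtMost_iff)
      moreover have "v t = V t 0 (v 0) + duhamel (superpos v) t" using v t mild_iff[OF cv] by (meson atLeastAtMost_iff)
      ultimately show ?thesis unfolding eq by simp
    qed
    also have "norm \<dots> \<le> C * L * c / \<mu> * exp (\<mu> * t)"
      by (rule duhamel_superpos_diff[OF cu cv]) (use t \<mu> c C le in auto)
    also have "\<dots> = (C * L / \<mu>) * c * exp (\<mu> * t)" by simp
    also have "\<dots> \<le> (1 / 2) * c * exp (\<mu> * t)" using \<mu>(2) c by (intro mult_right_mono) auto
    finally show "norm (u t - v t) \<le> (0 + c / 2) * exp (\<mu> * t)" by simp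
  qed (use T in auto)
  then show ?thesis by simp
qed

text \<open>The bounds of \<open>V\<close> may grow arbitrarily fast in time, so no single
  exponential need work on the whole half-line. The weight gets a constant and a rate that increase
  with \<open>t\<close>, which makes the Picard map a global contraction.\<close>

lemma mild_exists: "\<exists>u. mild u \<and> u 0 = x"
proof -
  have "\<forall>n. \<exists>C. 0 \<le> C \<and> (\<forall>s t x. 0 \<le> s \<longrightarrow> s \<le> t \<longrightarrow> t \<le> real n \<longrightarrow> norm (V t s x) \<le> C * norm x)"
    using V_bound by simp
  from choice[OF this] obtain C
    where *: "\<forall>n. 0 \<le> C n \<and> (\<forall>s t x. 0 \<le> s \<longrightarrow> s \<le> t \<longrightarrow> t \<le> real n \<longrightarrow> norm (V t s x) \<le> C n * norm x)" ..
  have C: "0 \<le> C n" "0 \<le> s \<Longrightarrow> s \<le> t \<Longrightarrow> t \<le> real n \<Longrightarrow> norm (V t s x) \<le> C n * norm x" for n s t x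
    using *[THEN spec, of n] by simp_all
  \<comment> \<open>A sum of nonnegative constants, one per integer up to the ceiling of
    \<open>t\<close>: it is nondecreasing in \<open>t\<close> and dominates the constant valid up to
    time \<open>t\<close>.\<close>
  define D where "D t = (\<Sum>k\<le>nat \<lceil>t\<rceil>. C k)" for t :: real
  have D0: "0 \<le> D t" for t unfolding D_def by (intro sum_nonneg C)
  have Dmono: "D s \<le> D t" if "s \<le> t" for s t
  proof -
    have "nat \<lceil>s\<rceil> \<le> nat \<lceil>t\<rceil>" using that by (intro nat_mono ceiling_mono)
    then show ?thesis unfolding D_def by (intro sum_mono2) (auto simp: C)
  qed
  have DV: "norm (V t s x) \<le> D t * norm x" if "0 \<le> s" "s \<le> t" for s t x
  proof -
    have "norm (V t s x) \<le> C (nat \<lceil>t\<rceil>) * norm x"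
      using that by (intro C(2)) (auto simp: real_nat_ceiling_ge)
    also have "C (nat \<lceil>t\<rceil>) \<le> D t"
      unfolding D_def by (rule member_le_sum) (auto simp: C)
    finally show ?thesis by (simp add: mult_right_mono)
  qed
  define \<mu> where "\<mu> t = 2 * D t * L + 1" for t
  have \<mu>: "0 < \<mu> t" "D t * L / \<mu> t \<le> 1 / 2" for t
  proof -
    have "0 \<le> D t * L" using D0 L_nonneg by simp
    then show "0 < \<mu> t" "D t * L / \<mu> t \<le> 1 / 2" by (simp_all add: \<mu>_def divide_le_eq)
  qed
  have \<mu>mono: "\<mu> s \<le> \<mu> t" if "s \<le> t" for s t
    unfolding \<mu>_def using Dmono[OF that] L_nonneg by (simp add: mult_right_mono)
  \<comment> \<open>The factor \<open>1 + D t\<close> dominates the linear term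
    \<open>V t 0 x\<close> up to \<open>norm x\<close> and stays positive even where
    \<open>D t\<close> is zero.\<close>
  define w where "w t = (1 + D t) * exp (\<mu> t * t)" for t
  \<comment> \<open>Freezing constant and rate at the final time bounds \<open>w\<close> on
    \<open>{0..t}\<close> by a pure exponential, the form required by
    \<open>duhamel_superpos_diff\<close>.\<close>
  have w_le: "w s \<le> (1 + D t) * exp (\<mu> t * s)" if "0 \<le> s" "s \<le> t" for s t
    unfolding w_def using that Dmono[OF that(2)] \<mu>mono[OF that(2)] D0[of t]
    by (intro mult_mono) (auto intro: mult_right_mono)
  define \<Phi> where "\<Phi> u t = V t 0 x + duhamel (superpos u) t" for u t
  have "\<exists>u K. continuous_on {0..} u \<and> (\<forall>t\<ge>0. norm (u t) \<le> K * w t) \<and> (\<forall>t\<ge>0. \<Phi> u t = u t)"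
  proof (rule weighted_fixed_point[where K = "norm x"])
    show "0 < w t" for t unfolding w_def using D0[of t] by (intro mult_pos_pos) auto
    show "\<exists>B. \<forall>t\<in>{0..T}. w t \<le> B" for T
    proof (intro exI ballI)
      fix t assume t: "t \<in> {0..T}"
      then have "w t \<le> (1 + D T) * exp (\<mu> T * t)" by (intro w_le) auto
      also have "\<dots> \<le> (1 + D T) * exp (\<mu> T * T)"
        using D0[of T] t \<mu>(1)[of T] by (intro mult_left_mono) auto
      finally show "w t \<le> (1 + D T) * exp (\<mu> T * T)" .
    qed
    show "continuous_on {0..} (\<Phi> u)" if u: "continuous_on {0..} u" for u
      unfolding \<Phi>_def
      by (intro continuous_on_add continuous_on_V_left continuous_on_duhamel superpos_measurable
          superpos_bounded u)
    show "norm (\<Phi> (\<lambda>_. 0) t) \<le> norm x * w t" if t: "0 \<le> t" for t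
    proof -
      have "duhamel (superpos (\<lambda>_. 0)) t = (LINT \<tau>:{0..t}|lborel. 0)"
        by (rule set_lebesgue_integral_cong)
          (auto simp: g_0 linear_simps(3)[OF linear_V])
      then have "\<Phi> (\<lambda>_. 0) t = V t 0 x" by (simp add: \<Phi>_def)
      also have "norm \<dots> \<le> D t * norm x" by (rule DV) (use t in auto)
      also have "\<dots> \<le> w t * norm x"
      proof (rule mult_right_mono)
        have "(1 + D t) * 1 \<le> w t"
          unfolding w_def using D0[of t] t \<mu>(1)[of t] by (intro mult_left_mono) auto
        then show "D t \<le> w t" by simp
      qed simp
      finally show ?thesis by (simp add: mult.commute)
    qed
  next
    fix u v :: "real \<Rightarrow> 'h" and K c t :: real
    assume u: "continuous_on {0..} u" and v: "continuous_on {0..} v" and c: "0 \<le> c" and t: "0 \<le> t"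
      and le: "\<And>t. 0 \<le> t \<Longrightarrow> norm (u t - v t) \<le> c * w t"
    have le': "norm (u \<tau> - v \<tau>) \<le> c * (1 + D t) * exp (\<mu> t * \<tau>)" if "0 \<le> \<tau>" "\<tau> \<le> t" for \<tau>
      using order_trans[OF le[OF that(1)] mult_left_mono[OF w_le[OF that] c]] by (simp add: mult.assoc)
    have "\<Phi> u t - \<Phi> v t = duhamel (superpos u) t - duhamel (superpos v) t"
      by (simp add: \<Phi>_def)
    also have "norm \<dots> \<le> D t * L * (c * (1 + D t)) / \<mu> t * exp (\<mu> t * t)"
      by (rule duhamel_superpos_diff[OF u v t \<mu>(1) _ D0 DV le']) (use c D0[of t] in auto)
    also have "\<dots> = (D t * L / \<mu> t) * (c * w t)" by (simp add: w_def)
    also have "\<dots> \<le> 1 / 2 * (c * w t)"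
      using c D0[of t] \<mu>(2)[of t] by (intro mult_right_mono) (auto simp: w_def)
    finally show "norm (\<Phi> u t - \<Phi> v t) \<le> c / 2 * w t" by simp
  qed
  then obtain u where u: "continuous_on {0..} u" "\<And>t. 0 \<le> t \<Longrightarrow> u t = \<Phi> u t" by metis
  with u(2)[of 0] have "u 0 = x" unfolding \<Phi>_def duhamel_0 by (simp add: V_refl)
  moreover from this have "mild u" using u by (simp add: mild_iff \<Phi>_def)
  ultimately show ?thesis by blast
qed

section \<open>The solution as a definite description\<close>

lemma mild_continuous: "mild u \<Longrightarrow> continuous_on {0..} u"
  by (simp only: mild_def)

lemma mild_cong:
  assumes "mild u" "\<And>t. 0 \<le> t \<Longrightarrow> u t = v t"
  shows "mild v"
proof -
  have cu: "continuous_on {0..} u" by (rule mild_continuous[OF assms(1)])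
  have cv: "continuous_on {0..} v"
    using continuous_on_cong[of "{0..}" "{0..}" u v] assms(2) cu by simp
  have "superpos u = superpos v" using assms(2) by (simp add: superpos_def fun_eq_iff)
  with assms show ?thesis unfolding mild_iff[OF cu] mild_iff[OF cv] by (metis order_refl)
qed

text \<open>Uniqueness on the half-line and the prescribed zero at negative times leave exactly one
  candidate, so the description denotes it.\<close>

lemma the_mild:
  assumes u: "mild u"
  shows "(THE v. mild v \<and> v 0 = u 0 \<and> (\<forall>t<0. v t = 0)) = (\<lambda>t. if t < 0 then 0 else u t)"
proof (rule the_equality)
  show "mild (\<lambda>t. if t < 0 then 0 else u t) \<and> (if 0 < (0::real) then 0 else u 0) = u 0
      \<and> (\<forall>t<0. (if t < 0 then 0 else u t) = 0)"
    using mild_cong[OF u, of "\<lambda>t. if t < 0 then 0 else u t"] by simp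
  fix v assume v: "mild v \<and> v 0 = u 0 \<and> (\<forall>t<0. v t = 0)"
  show "v = (\<lambda>t. if t < 0 then 0 else u t)"
  proof
    fix t show "v t = (if t < 0 then 0 else u t)"
      using mild_unique[of v u t] u v by (cases "t < 0") auto
  qed
qed

end

subsection \<open>Dichotomies and the Green operator\<close>

text \<open>
  The operator \<open>J \<tau>\<close> stands for the unstable projection at time \<open>\<tau>\<close> followed by the transport
  along the unstable spaces back to time \<open>0\<close>. The unstable projection at time \<open>\<tau>\<close> is
  \<open>V \<tau> 0 \<circ> J \<tau>\<close>, and \<open>V t 0 \<circ> J \<tau>\<close> for \<open>t \<le> \<tau>\<close> is the backward evolution from \<open>\<tau>\<close> to \<open>t\<close>.
\<close>
locale dichotomous_evolution = semilinear_evolution V g L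
  for V :: "real \<Rightarrow> real \<Rightarrow> 'h \<Rightarrow> 'h::{banach, second_countable_topology}"
    and g :: "real \<Rightarrow> 'h \<Rightarrow> 'h" and L :: real +
  fixes J :: "real \<Rightarrow> 'h \<Rightarrow> 'h" and \<kappa> :: "real \<Rightarrow> real" and \<alpha> \<beta> :: real
  assumes linear_J: "0 \<le> \<tau> \<Longrightarrow> bounded_linear (J \<tau>)"
    and J_V: "0 \<le> s \<Longrightarrow> s \<le> t \<Longrightarrow> J t (V t s x) = J s x"
    and J_J: "0 \<le> \<tau> \<Longrightarrow> J 0 (J \<tau> x) = J \<tau> x"
    and stable: "0 \<le> \<tau> \<Longrightarrow> \<tau> \<le> t \<Longrightarrow>
          norm (V t \<tau> (x - V \<tau> 0 (J \<tau> x))) \<le> \<kappa> \<tau> * exp (\<beta> * (t - \<tau>)) * norm x"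
    and unstable: "0 \<le> t \<Longrightarrow> t \<le> \<tau> \<Longrightarrow>
          norm (V t 0 (J \<tau> x)) \<le> \<kappa> \<tau> * exp (\<alpha> * (t - \<tau>)) * norm x"
    and gap: "\<beta> < \<alpha>"
    and \<kappa>_ge_1: "0 \<le> \<tau> \<Longrightarrow> 1 \<le> \<kappa> \<tau>"
    and \<kappa>_subexp: "((\<lambda>t. \<kappa> t * exp (- ((\<alpha> - \<beta>) / 2) * t)) \<longlongrightarrow> 0) at_top"
    and g_small: "0 \<le> \<tau> \<Longrightarrow> \<kappa> \<tau> * norm (g \<tau> x - g \<tau> y) \<le> (\<alpha> - \<beta>) / 8 * norm (x - y)"
begin

definition \<gamma> :: real where "\<gamma> = (\<alpha> + \<beta>) / 2"
text \<open>The distance of \<open>\<gamma>\<close> from either rate, and the exponent left over in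
  both parts of the Green integral.\<close>

definition \<delta> :: real where "\<delta> = (\<alpha> - \<beta>) / 2"

lemma \<delta>_pos: "0 < \<delta>" using gap by (simp add: \<delta>_def)
lemma \<alpha>_minus_\<delta>: "\<alpha> - \<delta> = \<gamma>" and \<beta>_plus_\<delta>: "\<beta> + \<delta> = \<gamma>"
  by (simp_all add: \<gamma>_def \<delta>_def field_simps)

text \<open>On \<open>{0..n}\<close> the identity \<open>J_V\<close> writes \<open>J \<tau>\<close>
  as the fixed bounded operator \<open>J n\<close> after \<open>V n \<tau>\<close>, whose
  measurability is known; then \<open>n\<close> tends to infinity.\<close>

lemma J_measurable:
  assumes f: "f \<in> borel_measurable borel"
  shows "set_borel_measurable lborel {0..} (\<lambda>\<tau>. J \<tau> (f \<tau>))"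
proof -
  have "(\<lambda>\<tau>. indicator {0..real n} \<tau> *\<^sub>R J \<tau> (f \<tau>)) \<in> borel_measurable lborel" for n
  proof -
    have "J (real n) \<in> borel_measurable borel"
      by (intro borel_measurable_continuous_onI linear_continuous_on linear_J) simp
    then have "(\<lambda>\<tau>. J (real n) (indicator {0..real n} \<tau> *\<^sub>R V (real n) \<tau> (f \<tau>))) \<in> borel_measurable lborel"
      using V_measurable[OF f, of "real n"] unfolding set_borel_measurable_def
      by (intro measurable_compose[of _ lborel borel "J (real n)"]) auto
    also have "(\<lambda>\<tau>. J (real n) (indicator {0..real n} \<tau> *\<^sub>R V (real n) \<tau> (f \<tau>)))
        = (\<lambda>\<tau>. indicator {0..real n} \<tau> *\<^sub>R J \<tau> (f \<tau>))"
      using linear_simps(3,5)[OF linear_J[of "real n"]] by (auto simp: J_V split: split_indicator)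
    finally show ?thesis .
  qed
  moreover have "(\<lambda>n. indicator {0..real n} \<tau> *\<^sub>R J \<tau> (f \<tau>)) \<longlonglongrightarrow> indicator {0..} \<tau> *\<^sub>R J \<tau> (f \<tau>)" for \<tau>
  proof (rule tendsto_eventually)
    obtain N where "\<tau> \<le> real N" using real_arch_simple by blast
    then have "\<tau> \<le> real n" if "N \<le> n" for n
      using that by (meson of_nat_le_iff order_trans)
    then show "\<forall>\<^sub>F n in sequentially. indicator {0..real n} \<tau> *\<^sub>R J \<tau> (f \<tau>) = indicator {0..} \<tau> *\<^sub>R J \<tau> (f \<tau>)"
      by (auto simp: eventually_sequentially split: split_indicator intro!: exI[of _ N])
  qed
  ultimately show ?thesis
    unfolding set_borel_measurable_def by (rule borel_measurable_LIMSEQ_metric)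
qed

text \<open>The factor \<open>\<kappa> \<tau>\<close> is included so that it absorbs the nonuniform
  constant of the dichotomy at the time where the forcing acts; \<open>\<delta> / 4\<close> is the
  constant \<open>(\<alpha> - \<beta>) / 8\<close> of \<open>g_small\<close>.\<close>

definition forcing :: "real \<Rightarrow> (real \<Rightarrow> 'h) \<Rightarrow> bool" where
  "forcing c f \<longleftrightarrow> f \<in> borel_measurable borel
     \<and> (\<forall>\<tau>\<ge>0. \<kappa> \<tau> * norm (f \<tau>) \<le> \<delta> / 4 * c * exp (\<gamma> * \<tau>))"

section \<open>Admissible forcings and the integral of their unstable parts\<close>

lemma forcing_measurable: "forcing c f \<Longrightarrow> f \<in> borel_measurable borel"
  and forcing_le: "forcing c f \<Longrightarrow> 0 \<le> \<tau> \<Longrightarrow> \<kappa> \<tau> * norm (f \<tau>) \<le> \<delta> / 4 * c * exp (\<gamma> * \<tau>)"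
  by (auto simp: forcing_def)

lemma forcing_bounded:
  assumes "forcing c f"
  shows "\<exists>B. \<forall>\<tau>\<in>{0..T}. norm (f \<tau>) \<le> B"
proof -
  have "bounded ((\<lambda>\<tau>. \<delta> / 4 * c * exp (\<gamma> * \<tau>)) ` {0..T})"
    by (intro compact_imp_bounded compact_continuous_image continuous_intros compact_Icc)
  then obtain B where B: "\<And>\<tau>. \<tau> \<in> {0..T} \<Longrightarrow> norm (\<delta> / 4 * c * exp (\<gamma> * \<tau>)) \<le> B"
    unfolding bounded_iff by blast
  have "norm (f \<tau>) \<le> B" if "\<tau> \<in> {0..T}" for \<tau>
  proof -
    have "1 * norm (f \<tau>) \<le> \<kappa> \<tau> * norm (f \<tau>)"
      using that by (intro mult_right_mono \<kappa>_ge_1) auto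
    also have "\<dots> \<le> \<delta> / 4 * c * exp (\<gamma> * \<tau>)" using that by (intro forcing_le[OF assms]) auto
    also have "\<dots> \<le> B" using B[OF that] unfolding real_norm_def by linarith
    finally show ?thesis by simp
  qed
  then show ?thesis by blast
qed

text \<open>Growth \<open>\<gamma>\<close> of the forcing against backward decay
  \<open>\<alpha>\<close> leaves \<open>exp (- \<delta> * \<tau>)\<close>, which is integrable up to
  infinity.\<close>

lemma forcing_backward_le:
  assumes f: "forcing c f" and t: "0 \<le> t" "t \<le> \<tau>"
  shows "norm (V t 0 (J \<tau> (f \<tau>))) \<le> \<delta> / 4 * c * exp (\<alpha> * t) * exp (- \<delta> * \<tau>)"
proof -
  have "norm (V t 0 (J \<tau> (f \<tau>))) \<le> \<kappa> \<tau> * norm (f \<tau>) * exp (\<alpha> * (t - \<tau>))"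
    using unstable[OF t, of "f \<tau>"] by (simp add: mult_ac)
  also have "\<dots> \<le> \<delta> / 4 * c * exp (\<gamma> * \<tau>) * exp (\<alpha> * (t - \<tau>))"
    using t by (intro mult_right_mono forcing_le[OF f]) auto
  also have "\<dots> = \<delta> / 4 * c * (exp (\<gamma> * \<tau>) * exp (\<alpha> * (t - \<tau>)))" by simp
  also have "exp (\<gamma> * \<tau>) * exp (\<alpha> * (t - \<tau>)) = exp (\<alpha> * t) * exp (- \<delta> * \<tau>)"
    unfolding exp_add[symmetric] \<alpha>_minus_\<delta>[symmetric] by (simp add: algebra_simps)
  finally show ?thesis by (simp add: mult.assoc)
qed

lemma J_integrable:
  assumes f: "forcing c f"
  shows "set_integrable lborel {0..} (\<lambda>\<tau>. J \<tau> (f \<tau>))"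
proof (rule set_integral_norm_le(1))
  show "set_integrable lborel {0..} (\<lambda>\<tau>. \<delta> / 4 * c * exp (- \<delta> * \<tau>))"
    by (intro set_integrable_mult_right exp_integral_atLeast \<delta>_pos)
  show "norm (J \<tau> (f \<tau>)) \<le> \<delta> / 4 * c * exp (- \<delta> * \<tau>)" if "\<tau> \<in> {0..}" for \<tau>
    using forcing_backward_le[OF f, of 0 \<tau>] that by (simp add: V_refl)
qed (rule J_measurable[OF forcing_measurable[OF f]])

abbreviation backward :: "(real \<Rightarrow> 'h) \<Rightarrow> 'h" where
  "backward f \<equiv> (LINT \<tau>:{0..}|lborel. J \<tau> (f \<tau>))"

lemma backward_le:
  assumes f: "forcing c f"
  shows "norm (backward f) \<le> c / 4"
proof -
  have "norm (backward f) \<le> (LINT \<tau>:{0..}|lborel. \<delta> / 4 * c * exp (- \<delta> * \<tau>))"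
  proof (rule set_integral_norm_le(2))
    show "set_integrable lborel {0..} (\<lambda>\<tau>. \<delta> / 4 * c * exp (- \<delta> * \<tau>))"
      by (intro set_integrable_mult_right exp_integral_atLeast \<delta>_pos)
    show "norm (J \<tau> (f \<tau>)) \<le> \<delta> / 4 * c * exp (- \<delta> * \<tau>)" if "\<tau> \<in> {0..}" for \<tau>
      using forcing_backward_le[OF f, of 0 \<tau>] that by (simp add: V_refl)
  qed (rule J_measurable[OF forcing_measurable[OF f]])
  then show ?thesis using exp_integral_atLeast(2)[OF \<delta>_pos, of 0] \<delta>_pos by simp
qed

text \<open>For \<open>t \<ge> 0\<close> this is the convolution of \<open>f\<close> with the Green function of the dichotomy.\<close>
definition green :: "(real \<Rightarrow> 'h) \<Rightarrow> real \<Rightarrow> 'h" where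
  "green f t = duhamel f t - V t 0 (backward f)"

text \<open>Cutting at \<open>t\<close> leaves the stable part of the forcing before
  \<open>t\<close> and the unstable part after \<open>t\<close>. The exponential integrals
  contribute \<open>1 / \<delta>\<close>, so each piece is at most a quarter of
  \<open>c * exp (\<gamma> * t)\<close>.\<close>

lemma green_le:
  assumes f: "forcing c f" and t: "0 \<le> t"
  shows "norm (green f t) \<le> c / 2 * exp (\<gamma> * t)"
proof -
  have iJ: "set_integrable lborel {0..} (\<lambda>\<tau>. J \<tau> (f \<tau>))" by (rule J_integrable[OF f])
  have i1: "set_integrable lborel {0..t} (\<lambda>\<tau>. J \<tau> (f \<tau>))"
    by (rule set_integrable_subset[OF iJ]) auto
  have i2: "set_integrable lborel {t..} (\<lambda>\<tau>. J \<tau> (f \<tau>))"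
    by (rule set_integrable_subset[OF iJ]) (use t in auto)
  have lin: "bounded_linear (V t 0)" by (rule linear_V) (use t in auto)
  note b1 = set_integral_bounded_linear[OF lin i1] and b2 = set_integral_bounded_linear[OF lin i2]
  have iV: "set_integrable lborel {0..t} (\<lambda>\<tau>. V t \<tau> (f \<tau>))"
    by (rule duhamel_shift(1)[OF forcing_measurable[OF f] forcing_bounded[OF f]]) (use t in auto)
  let ?h = "\<lambda>\<tau>. V t \<tau> (f \<tau>) - V t 0 (J \<tau> (f \<tau>))"
  have ih: "set_integrable lborel {0..t} ?h" by (rule set_integral_diff(1)[OF iV b1(1)])
  have "{0..} = {0..t} \<union> {t..}" using t by auto
  then have "backward f = (LINT \<tau>:{0..t} \<union> {t..}|lborel. J \<tau> (f \<tau>))" by simp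
  also have "\<dots> = (LINT \<tau>:{0..t}|lborel. J \<tau> (f \<tau>)) + (LINT \<tau>:{t..}|lborel. J \<tau> (f \<tau>))"
    by (rule set_integral_overlap_Un[OF i1 i2, of t]) auto
  finally have split: "green f t = (LINT \<tau>:{0..t}|lborel. ?h \<tau>) - (LINT \<tau>:{t..}|lborel. V t 0 (J \<tau> (f \<tau>)))"
    unfolding green_def set_integral_diff(2)[OF iV b1(1)] b1(2) b2(2)
    by (simp add: linear_simps(1)[OF lin])
  have "norm (LINT \<tau>:{0..t}|lborel. ?h \<tau>) \<le> (LINT \<tau>:{0..t}|lborel. \<delta> / 4 * c * exp (\<beta> * t) * exp (\<delta> * \<tau>))"
  proof (rule set_integral_norm_le(2))
    show "set_integrable lborel {0..t} (\<lambda>\<tau>. \<delta> / 4 * c * exp (\<beta> * t) * exp (\<delta> * \<tau>))"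
      by (intro borel_integrable_atLeastAtMost' continuous_intros)
    show "set_borel_measurable lborel {0..t} ?h"
      using ih by (auto simp: set_integrable_def set_borel_measurable_def)
    fix \<tau> assume \<tau>: "\<tau> \<in> {0..t}"
    have "?h \<tau> = V t \<tau> (f \<tau>) - V t \<tau> (V \<tau> 0 (J \<tau> (f \<tau>)))"
      using \<tau> by (simp add: V_comp)
    also have "\<dots> = V t \<tau> (f \<tau> - V \<tau> 0 (J \<tau> (f \<tau>)))"
      using linear_simps(2)[OF linear_V[of \<tau> t]] \<tau> by simp
    also have "norm \<dots> \<le> \<kappa> \<tau> * norm (f \<tau>) * exp (\<beta> * (t - \<tau>))"
      using stable[of \<tau> t "f \<tau>"] \<tau> by (simp add: mult_ac)
    also have "\<dots> \<le> \<delta> / 4 * c * exp (\<gamma> * \<tau>) * exp (\<beta> * (t - \<tau>))"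
      using \<tau> by (intro mult_right_mono forcing_le[OF f]) auto
    also have "\<dots> = \<delta> / 4 * c * (exp (\<gamma> * \<tau>) * exp (\<beta> * (t - \<tau>)))" by simp
    also have "exp (\<gamma> * \<tau>) * exp (\<beta> * (t - \<tau>)) = exp (\<beta> * t) * exp (\<delta> * \<tau>)"
      unfolding exp_add[symmetric] \<beta>_plus_\<delta>[symmetric] by (simp add: algebra_simps)
    finally show "norm (?h \<tau>) \<le> \<delta> / 4 * c * exp (\<beta> * t) * exp (\<delta> * \<tau>)" by (simp add: mult.assoc)
  qed
  also have "\<dots> = c / 4 * (exp (\<beta> * t) * (exp (\<delta> * t) - 1))"
    unfolding set_integral_mult_right exp_integral_atLeastAtMost[OF less_imp_neq[OF \<delta>_pos, symmetric] t]
    using \<delta>_pos by simp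
  also have "\<dots> \<le> c / 4 * exp (\<gamma> * t)"
  proof (rule mult_left_mono)
    show "exp (\<beta> * t) * (exp (\<delta> * t) - 1) \<le> exp (\<gamma> * t)"
      unfolding \<beta>_plus_\<delta>[symmetric] by (simp add: algebra_simps flip: exp_add)
    \<comment> \<open>The sign of \<open>c\<close> is not recorded in \<open>forcing\<close>; it is
      read off from the bound on a norm.\<close>
    have "0 \<le> norm (backward f)" by simp
    also have "\<dots> \<le> c / 4" by (rule backward_le[OF f])
    finally show "0 \<le> c / 4" .
  qed
  finally have head: "norm (LINT \<tau>:{0..t}|lborel. ?h \<tau>) \<le> c / 4 * exp (\<gamma> * t)" .
  have "norm (LINT \<tau>:{t..}|lborel. V t 0 (J \<tau> (f \<tau>)))
      \<le> (LINT \<tau>:{t..}|lborel. \<delta> / 4 * c * exp (\<alpha> * t) * exp (- \<delta> * \<tau>))"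
  proof (rule set_integral_norm_le(2))
    show "set_integrable lborel {t..} (\<lambda>\<tau>. \<delta> / 4 * c * exp (\<alpha> * t) * exp (- \<delta> * \<tau>))"
      by (intro set_integrable_mult_right exp_integral_atLeast \<delta>_pos)
    show "set_borel_measurable lborel {t..} (\<lambda>\<tau>. V t 0 (J \<tau> (f \<tau>)))"
      using b2(1) by (auto simp: set_integrable_def set_borel_measurable_def)
  qed (use forcing_backward_le[OF f t] in auto)
  also have "\<dots> = c / 4 * (exp (\<alpha> * t) * exp (- \<delta> * t))"
    unfolding set_integral_mult_right exp_integral_atLeast(2)[OF \<delta>_pos] using \<delta>_pos by simp
  also have "\<dots> = c / 4 * exp (\<gamma> * t)"
    unfolding \<alpha>_minus_\<delta>[symmetric] by (simp add: algebra_simps flip: exp_add)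
  finally have tail: "norm (LINT \<tau>:{t..}|lborel. V t 0 (J \<tau> (f \<tau>))) \<le> c / 4 * exp (\<gamma> * t)" .
  show ?thesis
    unfolding split using head tail
      norm_triangle_ineq4[of "LINT \<tau>:{0..t}|lborel. ?h \<tau>" "LINT \<tau>:{t..}|lborel. V t 0 (J \<tau> (f \<tau>))"]
    by simp
qed

section \<open>Linearity of the Green operator\<close>

lemma backward_diff:
  assumes f: "forcing c f" and f': "forcing c' f'"
  shows "backward (\<lambda>\<tau>. f \<tau> - f' \<tau>) = backward f - backward f'"
proof -
  have "backward (\<lambda>\<tau>. f \<tau> - f' \<tau>) = (LINT \<tau>:{0..}|lborel. J \<tau> (f \<tau>) - J \<tau> (f' \<tau>))"
    by (rule set_lebesgue_integral_cong) (auto simp: linear_simps(2)[OF linear_J])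
  also have "\<dots> = backward f - backward f'"
    by (rule set_integral_diff(2)[OF J_integrable[OF f] J_integrable[OF f']])
  finally show ?thesis .
qed

lemma green_diff:
  assumes f: "forcing c f" and f': "forcing c' f'" and t: "0 \<le> t"
  shows "green (\<lambda>\<tau>. f \<tau> - f' \<tau>) t = green f t - green f' t"
proof -
  have i: "set_integrable lborel {0..t} (\<lambda>\<tau>. V t \<tau> (f \<tau>))"
    "set_integrable lborel {0..t} (\<lambda>\<tau>. V t \<tau> (f' \<tau>))"
    by (rule duhamel_shift(1)[OF forcing_measurable[OF f] forcing_bounded[OF f]]
        duhamel_shift(1)[OF forcing_measurable[OF f'] forcing_bounded[OF f']]; use t in simp)+
  have "duhamel (\<lambda>\<tau>. f \<tau> - f' \<tau>) t = (LINT \<tau>:{0..t}|lborel. V t \<tau> (f \<tau>) - V t \<tau> (f' \<tau>))"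
    by (rule set_lebesgue_integral_cong) (auto simp: linear_simps(2)[OF linear_V])
  also have "\<dots> = duhamel f t - duhamel f' t"
    by (rule set_integral_diff(2)[OF i])
  finally show ?thesis
    unfolding green_def backward_diff[OF f f'] using linear_simps(2)[OF linear_V[of 0 t]] t by simp
qed

end

subsection \<open>The Lyapunov--Perron equation\<close>

context dichotomous_evolution
begin

text \<open>The ball of radius \<open>c\<close> in the weighted norm of the space of solutions with
  rate \<open>\<gamma>\<close>.\<close>

definition growth_le :: "real \<Rightarrow> (real \<Rightarrow> 'h) \<Rightarrow> bool" where
  "growth_le c u \<longleftrightarrow> (\<forall>t\<ge>0. norm (u t) \<le> c * exp (\<gamma> * t))"

lemma forcing_superpos_diff:
  assumes u: "continuous_on {0..} u" and v: "continuous_on {0..} v"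
    and d: "growth_le c (\<lambda>t. u t - v t)"
  shows "forcing c (\<lambda>\<tau>. superpos u \<tau> - superpos v \<tau>)"
  unfolding forcing_def
proof (intro conjI allI impI)
  show "(\<lambda>\<tau>. superpos u \<tau> - superpos v \<tau>) \<in> borel_measurable borel"
    by (intro borel_measurable_diff superpos_measurable u v)
  fix \<tau> :: real assume \<tau>: "0 \<le> \<tau>"
  have "\<kappa> \<tau> * norm (superpos u \<tau> - superpos v \<tau>) \<le> \<delta> / 4 * norm (u \<tau> - v \<tau>)"
    using g_small[OF \<tau>] \<tau> by (simp add: \<delta>_def)
  also have "\<dots> \<le> \<delta> / 4 * (c * exp (\<gamma> * \<tau>))"
    using d \<tau> \<delta>_pos by (intro mult_left_mono) (auto simp: growth_le_def)
  finally show "\<kappa> \<tau> * norm (superpos u \<tau> - superpos v \<tau>) \<le> \<delta> / 4 * c * exp (\<gamma> * \<tau>)"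
    by (simp add: mult.assoc)
qed

lemma forcing_superpos:
  assumes "continuous_on {0..} u" "growth_le c u"
  shows "forcing c (superpos u)"
proof -
  have "superpos (\<lambda>_. 0) = (\<lambda>_. 0)" by (simp add: superpos_def g_0 fun_eq_iff)
  then show ?thesis using forcing_superpos_diff[of u "\<lambda>_. 0" c] assms by simp
qed

lemma forcing_superpos_zero: "forcing 0 (superpos (\<lambda>_. 0))"
  by (rule forcing_superpos) (auto simp: growth_le_def)

text \<open>The parameter \<open>\<xi>\<close> is meant to be the stable component of the initial
  value; the unstable component is supplied by \<open>green\<close> at time
  \<open>0\<close>.\<close>

definition lp_solution :: "'h \<Rightarrow> (real \<Rightarrow> 'h) \<Rightarrow> bool" where
  "lp_solution \<xi> u \<longleftrightarrow> continuous_on {0..} u \<and> (\<exists>c. growth_le c u)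
     \<and> (\<forall>t\<ge>0. u t = V t 0 \<xi> + green (superpos u) t)"

text \<open>A vector killed by \<open>J 0\<close> is its own stable part, so it obeys the rate
  \<open>\<beta>\<close>, which lies below \<open>\<gamma>\<close>.\<close>

lemma kernel_decay:
  assumes "J 0 \<xi> = 0" "0 \<le> t"
  shows "norm (V t 0 \<xi>) \<le> \<kappa> 0 * norm \<xi> * exp (\<gamma> * t)"
proof -
  have "V 0 0 (J 0 \<xi>) = 0" using assms(1) by (simp add: V_refl)
  then have "norm (V t 0 \<xi>) \<le> \<kappa> 0 * exp (\<beta> * t) * norm \<xi>"
    using stable[of 0 t \<xi>] assms(2) by simp
  also have "\<dots> \<le> \<kappa> 0 * exp (\<gamma> * t) * norm \<xi>"
  proof (intro mult_right_mono mult_left_mono)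
    show "exp (\<beta> * t) \<le> exp (\<gamma> * t)"
      unfolding \<beta>_plus_\<delta>[symmetric] using \<delta>_pos assms(2) by (simp add: distrib_right)
    show "0 \<le> \<kappa> 0" using \<kappa>_ge_1[of 0] by simp
  qed simp
  finally show ?thesis by (simp add: mult_ac)
qed

text \<open>Linearity of \<open>green\<close> turns a difference of images into \<open>green\<close>
  of a difference of forcings, and \<open>green_le\<close> then gives the contraction factor
  \<open>1/2\<close>.\<close>

lemma lp_solution_exists:
  assumes \<xi>: "J 0 \<xi> = 0"
  shows "\<exists>u. lp_solution \<xi> u"
proof -
  define \<Phi> where "\<Phi> u t = V t 0 \<xi> + green (superpos u) t" for u t
  have "\<exists>u C. continuous_on {0..} u \<and> (\<forall>t\<ge>0. norm (u t) \<le> C * exp (\<gamma> * t)) \<and> (\<forall>t\<ge>0. \<Phi> u t = u t)"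
  proof (rule weighted_fixed_point[where K = "\<kappa> 0 * norm \<xi>"])
    show "\<exists>B. \<forall>t\<in>{0..T}. exp (\<gamma> * t) \<le> B" for T
    proof (intro exI ballI)
      fix t assume t: "t \<in> {0..T}"
      have "\<gamma> * t \<le> \<bar>\<gamma>\<bar> * T"
        using t by (intro mult_mono) auto
      then show "exp (\<gamma> * t) \<le> exp (\<bar>\<gamma>\<bar> * T)" by simp
    qed
    show "continuous_on {0..} (\<Phi> u)" if u: "continuous_on {0..} u" for u
      unfolding \<Phi>_def green_def
      by (intro continuous_on_add continuous_on_diff continuous_on_V_left continuous_on_duhamel
          superpos_measurable superpos_bounded u)
    show "norm (\<Phi> (\<lambda>_. 0) t) \<le> \<kappa> 0 * norm \<xi> * exp (\<gamma> * t)" if t: "0 \<le> t" for t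
      using kernel_decay[OF \<xi> t] green_le[OF forcing_superpos_zero t] by (simp add: \<Phi>_def)
  next
    fix u v :: "real \<Rightarrow> 'h" and C c t :: real
    assume u: "continuous_on {0..} u" and v: "continuous_on {0..} v" and t: "0 \<le> t"
      and bu: "\<And>t. 0 \<le> t \<Longrightarrow> norm (u t) \<le> C * exp (\<gamma> * t)"
      and bv: "\<And>t. 0 \<le> t \<Longrightarrow> norm (v t) \<le> C * exp (\<gamma> * t)"
      and d: "\<And>t. 0 \<le> t \<Longrightarrow> norm (u t - v t) \<le> c * exp (\<gamma> * t)"
    have fu: "forcing C (superpos u)" and fv: "forcing C (superpos v)"
      by (rule forcing_superpos; use u v bu bv in \<open>simp add: growth_le_def\<close>)+
    have "\<Phi> u t - \<Phi> v t = green (\<lambda>\<tau>. superpos u \<tau> - superpos v \<tau>) t"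
      by (simp add: \<Phi>_def green_diff[OF fu fv t])
    also have "norm \<dots> \<le> c / 2 * exp (\<gamma> * t)"
      by (intro green_le[OF forcing_superpos_diff[OF u v] t]) (use d in \<open>simp add: growth_le_def\<close>)
    finally show "norm (\<Phi> u t - \<Phi> v t) \<le> c / 2 * exp (\<gamma> * t)" .
  qed simp
  then show ?thesis unfolding lp_solution_def growth_le_def \<Phi>_def by metis
qed

text \<open>The same factor \<open>1/2\<close> is absorbed into the left side, which doubles the
  linear term. For equal parameters this is uniqueness.\<close>

lemma lp_solution_lipschitz:
  assumes u: "lp_solution \<xi> u" and v: "lp_solution \<eta> v" and ker: "J 0 \<xi> = 0" "J 0 \<eta> = 0"
  shows "growth_le (2 * (\<kappa> 0 * norm (\<xi> - \<eta>))) (\<lambda>t. u t - v t)"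
proof -
  obtain cu cv where cu: "continuous_on {0..} u" "growth_le cu u"
    and cv: "continuous_on {0..} v" "growth_le cv v"
    using u v by (auto simp: lp_solution_def)
  have ker0: "J 0 (\<xi> - \<eta>) = 0" using ker linear_simps(2)[OF linear_J[of 0]] by simp
  note fu = forcing_superpos[OF cu] and fv = forcing_superpos[OF cv]
  have "norm (u t - v t) \<le> 2 * (\<kappa> 0 * norm (\<xi> - \<eta>)) * exp (\<gamma> * t)" if t: "0 \<le> t" for t
  proof (rule weighted_absorb[where I = "{0..}" and C = "cu + cv" and d = "\<lambda>t. norm (u t - v t)"])
    fix t :: real assume t: "t \<in> {0..}"
    have "norm (u t - v t) \<le> norm (u t) + norm (v t)" by (rule norm_triangle_ineq4)
    also have "\<dots> \<le> cu * exp (\<gamma> * t) + cv * exp (\<gamma> * t)"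
      using cu cv t by (intro add_mono) (auto simp: growth_le_def)
    finally show "norm (u t - v t) \<le> (cu + cv) * exp (\<gamma> * t)" by (simp add: distrib_right)
  next
    fix c t :: real
    assume d: "\<And>t. t \<in> {0..} \<Longrightarrow> norm (u t - v t) \<le> c * exp (\<gamma> * t)" and "t \<in> {0..}"
    then have t: "0 \<le> t" by simp
    have "u t = V t 0 \<xi> + green (superpos u) t" "v t = V t 0 \<eta> + green (superpos v) t"
      using u v t unfolding lp_solution_def by blast+
    then have "u t - v t = (V t 0 \<xi> - V t 0 \<eta>) + (green (superpos u) t - green (superpos v) t)"
      by (simp only: add_diff_add)
    also have "\<dots> = V t 0 (\<xi> - \<eta>) + green (\<lambda>\<tau>. superpos u \<tau> - superpos v \<tau>) t"
      using linear_simps(2)[OF linear_V[of 0 t]] t by (simp add: green_diff[OF fu fv])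
    also have "norm \<dots> \<le> \<kappa> 0 * norm (\<xi> - \<eta>) * exp (\<gamma> * t) + c / 2 * exp (\<gamma> * t)"
      by (intro norm_triangle_mono kernel_decay ker0 t green_le forcing_superpos_diff cu cv)
        (use d in \<open>simp add: growth_le_def\<close>)
    finally show "norm (u t - v t) \<le> (\<kappa> 0 * norm (\<xi> - \<eta>) + c / 2) * exp (\<gamma> * t)"
      by (simp add: distrib_right)
  qed (use that in auto)
  then show ?thesis by (simp add: growth_le_def)
qed

lemma J_0_backward:
  assumes f: "forcing c f"
  shows "J 0 (backward f) = backward f"
proof -
  have "J 0 (backward f) = (LINT \<tau>:{0..}|lborel. J 0 (J \<tau> (f \<tau>)))"
    by (rule set_integral_bounded_linear(2)[OF linear_J J_integrable[OF f], symmetric]) simp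
  also have "\<dots> = backward f"
    by (rule set_lebesgue_integral_cong) (auto simp: J_J)
  finally show ?thesis .
qed

lemma lp_solution_mild:
  assumes u: "lp_solution \<xi> u"
  shows "mild u" "u 0 = \<xi> - backward (superpos u)"
proof -
  have cu: "continuous_on {0..} u" and eq: "\<And>t. 0 \<le> t \<Longrightarrow> u t = V t 0 \<xi> + green (superpos u) t"
    using u by (auto simp: lp_solution_def)
  show 0: "u 0 = \<xi> - backward (superpos u)"
    using eq[of 0] unfolding green_def duhamel_0 by (simp add: V_refl)
  have "u t = V t 0 (u 0) + duhamel (superpos u) t" if t: "0 \<le> t" for t
    unfolding 0 using eq[OF t] linear_simps(2)[OF linear_V[of 0 t]] t by (simp add: green_def)
  then show "mild u" using mild_iff[OF cu] by blast
qed

text \<open>Growth at rate \<open>\<gamma>\<close> rules out any free unstable component: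
  \<open>J t (u t)\<close> tends to zero, and this limit fixes \<open>J 0 (u 0)\<close> in terms of
  the nonlinearity.\<close>

lemma mild_lp_solution:
  assumes u: "mild u" and c: "growth_le c u"
  shows "lp_solution (u 0 - J 0 (u 0)) u" "u 0 - J 0 (u 0) - backward (superpos u) = u 0"
proof -
  have cu: "continuous_on {0..} u" using u by (simp add: mild_def)
  note f = forcing_superpos[OF cu c]
  have eq: "u t = V t 0 (u 0) + duhamel (superpos u) t" if "0 \<le> t" for t
    using u mild_iff[OF cu] that by blast
  \<comment> \<open>Transport back to time \<open>0\<close> removes the linear evolution from the
    mild equation, so only the upper limit of the integral depends on \<open>t\<close>.\<close>
  have J_u: "J t (u t) = J 0 (u 0) + (LINT \<tau>:{0..t}|lborel. J \<tau> (superpos u \<tau>))" if t: "0 \<le> t" for t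
  proof -
    have "J t (u t) = J t (V t 0 (u 0)) + J t (duhamel (superpos u) t)"
      by (subst eq[OF t]) (rule linear_simps(1)[OF linear_J[OF t]])
    also have "J t (duhamel (superpos u) t) = (LINT \<tau>:{0..t}|lborel. J t (V t \<tau> (superpos u \<tau>)))"
      by (rule set_integral_bounded_linear(2)[OF linear_J[OF t] superpos_integrable[OF cu t], symmetric])
    also have "\<dots> = (LINT \<tau>:{0..t}|lborel. J \<tau> (superpos u \<tau>))"
      by (rule set_lebesgue_integral_cong) (auto simp: J_V)
    finally show ?thesis using t by (simp add: J_V)
  qed
  have "(\<lambda>n. LINT \<tau>:{0..real n}|lborel. J \<tau> (superpos u \<tau>)) \<longlonglongrightarrow> (LINT \<tau>:(\<Union>n. {0..real n})|lborel. J \<tau> (superpos u \<tau>))"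
  proof (rule set_integral_cont_up)
    show "set_integrable lborel (\<Union>n. {0..real n}) (\<lambda>\<tau>. J \<tau> (superpos u \<tau>))"
      by (rule set_integrable_subset[OF J_integrable[OF f]]) auto
  qed (auto simp: incseq_def)
  moreover have "(\<Union>n. {0..real n}) = {0..}" using real_arch_simple by auto
  ultimately have "(\<lambda>n. J 0 (u 0) + (LINT \<tau>:{0..real n}|lborel. J \<tau> (superpos u \<tau>))) \<longlonglongrightarrow> J 0 (u 0) + backward (superpos u)"
    by (intro tendsto_intros) simp
  moreover have "(\<lambda>n. J (real n) (u (real n))) = (\<lambda>n. J 0 (u 0) + (LINT \<tau>:{0..real n}|lborel. J \<tau> (superpos u \<tau>)))"
    by (intro ext J_u) simp
  ultimately have "(\<lambda>n. J (real n) (u (real n))) \<longlonglongrightarrow> J 0 (u 0) + backward (superpos u)"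
    by (simp only:)
  \<comment> \<open>Backward decay \<open>\<alpha>\<close> against growth \<open>\<gamma>\<close>
    leaves the exponent \<open>- \<delta>\<close>, which beats the subexponential
    \<open>\<kappa>\<close>.\<close>
  moreover have "(\<lambda>n. J (real n) (u (real n))) \<longlonglongrightarrow> 0"
  proof (rule Lim_null_comparison)
    show "\<forall>\<^sub>F n in sequentially. norm (J (real n) (u (real n))) \<le> \<kappa> (real n) * exp (- ((\<alpha> - \<beta>) / 2) * real n) * c"
    proof (rule always_eventually, rule allI)
      fix n :: nat
      have "norm (J (real n) (u (real n))) \<le> \<kappa> (real n) * exp (- \<alpha> * real n) * norm (u (real n))"
        using unstable[of 0 "real n" "u (real n)"] by (simp add: V_refl)
      also have "\<dots> \<le> \<kappa> (real n) * exp (- \<alpha> * real n) * (c * exp (\<gamma> * real n))"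
        using c \<kappa>_ge_1[of "real n"] by (intro mult_left_mono) (auto simp: growth_le_def)
      also have "\<dots> = \<kappa> (real n) * (exp (- \<alpha> * real n) * exp (\<gamma> * real n)) * c" by simp
      also have "exp (- \<alpha> * real n) * exp (\<gamma> * real n) = exp (- ((\<alpha> - \<beta>) / 2) * real n)"
        by (simp add: \<gamma>_def field_simps flip: exp_add)
      finally show "norm (J (real n) (u (real n))) \<le> \<kappa> (real n) * exp (- ((\<alpha> - \<beta>) / 2) * real n) * c" .
    qed
    show "(\<lambda>n. \<kappa> (real n) * exp (- ((\<alpha> - \<beta>) / 2) * real n) * c) \<longlonglongrightarrow> 0"
      by (rule tendsto_mult_left_zero[OF filterlim_compose[OF \<kappa>_subexp filterlim_real_sequentially]])
  qed
  ultimately have J0: "J 0 (u 0) = - backward (superpos u)"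
    by (metis LIMSEQ_unique add_eq_0_iff2)
  show "u 0 - J 0 (u 0) - backward (superpos u) = u 0" by (simp add: J0)
  show "lp_solution (u 0 - J 0 (u 0)) u"
    unfolding lp_solution_def
  proof (intro conjI allI impI exI[of _ c] cu c)
    fix t :: real assume t: "0 \<le> t"
    have "V t 0 (u 0 - J 0 (u 0)) + green (superpos u) t = V t 0 (u 0) + duhamel (superpos u) t"
      using linear_simps(1,2,4)[OF linear_V[of 0 t]] t by (simp add: green_def J0)
    then show "u t = V t 0 (u 0 - J 0 (u 0)) + green (superpos u) t" using eq[OF t] by simp
  qed
qed

section \<open>The graph over the stable space\<close>

lemma J_0_complement: "J 0 (x - J 0 x) = 0"
  using linear_simps(2)[OF linear_J[of 0]] by (simp add: J_J)

text \<open>The choice is harmless: for \<open>q\<close> in the kernel of \<open>J 0\<close>,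
  solutions agree at nonnegative times, and \<open>backward\<close> sees no others.\<close>

definition graph_map :: "'h \<Rightarrow> 'h" where
  "graph_map q = - backward (superpos (SOME u. lp_solution q u))"

lemma graph_map_eq:
  assumes u: "lp_solution q u" and q: "J 0 q = 0"
  shows "graph_map q = - backward (superpos u)"
proof -
  define v where "v = (SOME u. lp_solution q u)"
  have v: "lp_solution q v" unfolding v_def using u by (rule someI[where P = "lp_solution q"])
  have "u \<tau> = v \<tau>" if "0 \<le> \<tau>" for \<tau>
    using lp_solution_lipschitz[OF u v q q] that by (simp add: growth_le_def)
  then have "backward (superpos v) = backward (superpos u)"
    by (intro set_lebesgue_integral_cong) auto
  then show ?thesis by (simp add: graph_map_def v_def)
qed

theorem lyapunov_perron:
  shows "{u 0 | u c. mild u \<and> growth_le c u} = {q + graph_map q | q. J 0 q = 0}"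
    and "J 0 q = 0 \<Longrightarrow> J 0 (graph_map q) = graph_map q"
    and "(\<kappa> 0 / 2)-lipschitz_on {q. J 0 q = 0} graph_map"
    and "graph_map 0 = 0"
proof -
  show "{u 0 | u c. mild u \<and> growth_le c u} = {q + graph_map q | q. J 0 q = 0}"
  proof (intro equalityI subsetI; clarify)
    fix u c assume "mild u" "growth_le c u"
    note lp = mild_lp_solution[OF this]
    have "u 0 = (u 0 - J 0 (u 0)) + graph_map (u 0 - J 0 (u 0))"
      using lp(2) by (simp add: graph_map_eq[OF lp(1) J_0_complement])
    with J_0_complement show "\<exists>q. u 0 = q + graph_map q \<and> J 0 q = 0" by blast
  next
    fix q assume q: "J 0 q = 0"
    obtain u where u: "lp_solution q u" using lp_solution_exists[OF q] by blast
    have "q + graph_map q = u 0"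
      by (simp add: graph_map_eq[OF u q] lp_solution_mild(2)[OF u])
    with lp_solution_mild(1)[OF u] u show "\<exists>u c. q + graph_map q = u 0 \<and> mild u \<and> growth_le c u"
      unfolding lp_solution_def by blast
  qed
  show "J 0 (graph_map q) = graph_map q" if q: "J 0 q = 0"
  proof -
    obtain u where u: "lp_solution q u" using lp_solution_exists[OF q] by blast
    then obtain c where "continuous_on {0..} u" "growth_le c u" by (auto simp: lp_solution_def)
    from J_0_backward[OF forcing_superpos[OF this]] show ?thesis
      using linear_simps(4)[OF linear_J[of 0]] by (simp add: graph_map_eq[OF u q])
  qed
  \<comment> \<open>The constant is \<open>2 * \<kappa> 0\<close> from the dependence of the
    solution on its stable component, times \<open>1/4\<close> from
    \<open>backward_le\<close>.\<close>
  have lip: "norm (graph_map p - graph_map q) \<le> \<kappa> 0 / 2 * norm (p - q)"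
    if p: "J 0 p = 0" and q: "J 0 q = 0" for p q
  proof -
    obtain u v where u: "lp_solution p u" and v: "lp_solution q v"
      using lp_solution_exists p q by blast
    then obtain c c' where c: "continuous_on {0..} u" "growth_le c u"
      and c': "continuous_on {0..} v" "growth_le c' v" by (auto simp: lp_solution_def)
    note d = forcing_superpos_diff[OF c(1) c'(1) lp_solution_lipschitz[OF u v p q]]
    have "graph_map p - graph_map q = - backward (\<lambda>\<tau>. superpos u \<tau> - superpos v \<tau>)"
      unfolding backward_diff[OF forcing_superpos[OF c] forcing_superpos[OF c']]
      by (simp add: graph_map_eq[OF u p] graph_map_eq[OF v q])
    then show ?thesis using backward_le[OF d] by simp
  qed
  then show "(\<kappa> 0 / 2)-lipschitz_on {q. J 0 q = 0} graph_map"
    using \<kappa>_ge_1[of 0] by (auto simp: lipschitz_on_def dist_norm)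
  have J00: "J 0 0 = 0" using linear_simps(3)[OF linear_J[of 0]] by simp
  \<comment> \<open>The zero path gives a forcing of size \<open>0\<close>, so the zero function
    solves the equation with parameter zero.\<close>
  have "green (superpos (\<lambda>_. 0)) t = 0" if "0 \<le> t" for t
    using green_le[OF forcing_superpos_zero that] by simp
  then have "lp_solution 0 (\<lambda>_. 0)"
    unfolding lp_solution_def using linear_simps(3)[OF linear_V]
    by (auto simp: growth_le_def intro!: exI[of _ 0])
  then show "graph_map 0 = 0"
    using backward_le[OF forcing_superpos_zero] by (simp add: graph_map_eq[OF _ J00])
qed

text \<open>The truncated path appears because it is what the definite description of the solution
  returns.\<close>

lemma C_plus_iff:
  assumes u: "continuous_on {0..} u"
  shows "(\<lambda>t. if t < 0 then 0 else u t) \<in> C_plus \<gamma> \<longleftrightarrow> (\<exists>c. growth_le c u)"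
proof -
  have "continuous_on {0..} (\<lambda>t. if t < 0 then 0 else u t)"
    using continuous_on_cong[of "{0..}" "{0..}" "\<lambda>t. if t < 0 then 0 else u t" u] u by simp
  moreover have "norm (exp (- \<gamma> * t) *\<^sub>R x) \<le> c \<longleftrightarrow> norm x \<le> c * exp (\<gamma> * t)" for t c and x :: 'h
    by (simp add: exp_minus field_simps)
  moreover have "bdd_above ((\<lambda>t. norm (exp (- \<gamma> * t) *\<^sub>R (if t < 0 then 0 else u t))) ` {0..})
      \<longleftrightarrow> (\<exists>c. \<forall>t\<ge>0. norm (exp (- \<gamma> * t) *\<^sub>R u t) \<le> c)"
    unfolding bdd_above_def by (intro ex_cong1) auto
  ultimately show ?thesis
    unfolding C_plus_def growth_le_def by simp
qed

text \<open>Existence for every initial value matters here: without it the description could denote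
  an unspecified function that happens to have the right growth.\<close>

lemma stable_set_eq:
  "{x. (THE u. mild u \<and> u 0 = x \<and> (\<forall>t<0. u t = 0)) \<in> C_plus \<gamma>} = {u 0 | u c. mild u \<and> growth_le c u}"
proof (intro equalityI subsetI; clarify)
  fix x assume x: "(THE u. mild u \<and> u 0 = x \<and> (\<forall>t<0. u t = 0)) \<in> C_plus \<gamma>"
  obtain u where u: "mild u" "u 0 = x" using mild_exists by blast
  then have "\<exists>c. growth_le c u"
    using x the_mild[OF u(1)] C_plus_iff[OF mild_continuous[OF u(1)]] by simp
  with u show "\<exists>u c. x = u 0 \<and> mild u \<and> growth_le c u" by blast
next
  fix u c assume u: "mild u" and "growth_le c u"
  then have "(\<lambda>t. if t < 0 then 0 else u t) \<in> C_plus \<gamma>"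
    using C_plus_iff[OF mild_continuous[OF u]] by blast
  then show "(THE v. mild v \<and> v 0 = u 0 \<and> (\<forall>t<0. v t = 0)) \<in> C_plus \<gamma>"
    unfolding the_mild[OF u] .
qed

end

subsection \<open>Invariant splittings\<close>

text \<open>The difference of the two candidate components lies in both subspaces and is therefore
  zero.\<close>

lemma splitting_unique:
  assumes "splitting_projections E1 E2 P1 P2" "x \<in> E1" "y \<in> E2"
  shows "P1 (x + y) = x" "P2 (x + y) = y"
proof -
  have E: "subspace E1" "subspace E2" "E1 \<inter> E2 = {0}"
    and P: "P1 (x + y) \<in> E1" "P2 (x + y) \<in> E2" "x + y = P1 (x + y) + P2 (x + y)"
    using assms(1) unfolding splitting_projections_def by auto
  have eq: "P1 (x + y) - x = y - P2 (x + y)" using P(3) by (simp add: algebra_simps)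
  have "P1 (x + y) - x \<in> E1" using E(1) P(1) assms(2) by (rule subspace_diff)
  moreover have "P1 (x + y) - x \<in> E2" unfolding eq using E(2) assms(3) P(2) by (rule subspace_diff)
  ultimately have "P1 (x + y) - x = 0" using E(3) by blast
  with eq show "P1 (x + y) = x" "P2 (x + y) = y" by simp_all
qed

text \<open>Serves to obtain bounded operators from the inverses on the unstable spaces, which are
  only given as homeomorphisms.\<close>

lemma linear_continuous_bounded_linear:
  fixes f :: "'a::real_normed_vector \<Rightarrow> 'b::real_normed_vector"
  assumes f: "linear f" and cont: "continuous (at 0) f"
  shows "bounded_linear f"
proof -
  interpret linear f by fact
  have "\<exists>d>0. \<forall>x. dist x 0 < d \<longrightarrow> dist (f x) (f 0) < 1"
    using cont unfolding continuous_at_eps_delta by (rule allE[of _ 1]) simp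
  then obtain d where d: "0 < d" "\<And>x. norm x < d \<Longrightarrow> norm (f x) < 1"
    by (auto simp: zero)
  have "norm (f x) \<le> norm x * (2 / d)" for x
  proof (cases "x = 0")
    case False
    have "norm (f ((d / (2 * norm x)) *\<^sub>R x)) < 1" using False d(1) by (intro d(2)) simp
    then show ?thesis using False d(1) by (simp add: scale field_simps)
  qed (simp add: zero)
  then show ?thesis by (rule bounded_linear_intro[OF add scale])
qed

locale split_evolution = evolution_family V
  for V :: "real \<Rightarrow> real \<Rightarrow> 'h \<Rightarrow> 'h::{banach, second_countable_topology}" +
  fixes Es Eu :: "real \<Rightarrow> 'h set" and Ps Pu :: "real \<Rightarrow> 'h \<Rightarrow> 'h"
  assumes splitting: "0 \<le> t \<Longrightarrow> splitting_projections (Es t) (Eu t) (Ps t) (Pu t)"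
    and V_Es: "0 \<le> s \<Longrightarrow> s \<le> t \<Longrightarrow> V t s ` Es s \<subseteq> Es t"
    and V_Eu: "0 \<le> s \<Longrightarrow> s \<le> t \<Longrightarrow> homeomorphism (Eu s) (Eu t) (V t s) (inv_into (Eu s) (V t s))"
begin

text \<open>Projecting first makes the inverse on the unstable space an operator on all of the
  Hilbert space; \<open>pullback 0 \<tau>\<close> becomes the operator \<open>J \<tau>\<close> of
  the dichotomy.\<close>

definition pullback :: "real \<Rightarrow> real \<Rightarrow> 'h \<Rightarrow> 'h" where
  "pullback s t x = inv_into (Eu s) (V t s) (Pu t x)"

section \<open>Algebra and boundedness of the backward transport\<close>

lemma split: "0 \<le> t \<Longrightarrow> Ps t x \<in> Es t" "0 \<le> t \<Longrightarrow> Pu t x \<in> Eu t" "0 \<le> t \<Longrightarrow> Ps t x + Pu t x = x"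
  and linear_Pu: "0 \<le> t \<Longrightarrow> bounded_linear (Pu t)"
  and subspace_Eu: "0 \<le> t \<Longrightarrow> subspace (Eu t)"
  and subspace_Es: "0 \<le> t \<Longrightarrow> subspace (Es t)"
  using splitting[of t] unfolding splitting_projections_def by auto

lemma Pu_Eu: "0 \<le> t \<Longrightarrow> x \<in> Eu t \<Longrightarrow> Pu t x = x"
  using splitting_unique(2)[OF splitting, of t 0 x] subspace_0[OF subspace_Es] by simp

lemma Pu_Es: "0 \<le> t \<Longrightarrow> x \<in> Es t \<Longrightarrow> Pu t x = 0"
  using splitting_unique(2)[OF splitting, of t x 0] subspace_0[OF subspace_Eu] by simp

lemma V_image_Eu: "0 \<le> s \<Longrightarrow> s \<le> t \<Longrightarrow> V t s ` Eu s = Eu t"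
  and pullback_in_Eu: "0 \<le> s \<Longrightarrow> s \<le> t \<Longrightarrow> pullback s t x \<in> Eu s"
  and V_pullback: "0 \<le> s \<Longrightarrow> s \<le> t \<Longrightarrow> V t s (pullback s t x) = Pu t x"
proof -
  assume st: "0 \<le> s" "s \<le> t"
  show im: "V t s ` Eu s = Eu t" using V_Eu[OF st] by (simp add: homeomorphism_def)
  have P: "Pu t x \<in> V t s ` Eu s" unfolding im using st by (intro split) simp
  show "pullback s t x \<in> Eu s" unfolding pullback_def by (rule inv_into_into[OF P])
  show "V t s (pullback s t x) = Pu t x" unfolding pullback_def by (rule f_inv_into_f[OF P])
qed

text \<open>Injectivity of \<open>V t s\<close> on the unstable space characterises the preimage;
  the algebraic laws below are verified through this criterion.\<close>

lemma pullback_eqI: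
  assumes st: "0 \<le> s" "s \<le> t" and y: "y \<in> Eu s" "V t s y = Pu t x"
  shows "pullback s t x = y"
proof -
  have "inv_into (Eu s) (V t s) (V t s y) = y"
    using V_Eu[OF st] y(1) by (simp add: homeomorphism_def)
  then show ?thesis by (simp add: pullback_def y(2))
qed

text \<open>Both subspaces are carried into their counterparts, so \<open>V t s\<close> maps the
  decomposition at \<open>s\<close> to the one at \<open>t\<close>.\<close>

lemma Pu_V:
  assumes st: "0 \<le> s" "s \<le> t"
  shows "Pu t (V t s x) = V t s (Pu s x)"
proof -
  have t: "0 \<le> t" using st by simp
  have "V t s x = V t s (Ps s x) + V t s (Pu s x)"
    using linear_simps(1)[OF linear_V[OF st], of "Ps s x" "Pu s x"] split(3)[OF st(1)] by simp
  moreover have "V t s (Ps s x) \<in> Es t" using V_Es[OF st] split(1)[OF st(1)] by blast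
  moreover have "V t s (Pu s x) \<in> Eu t" using V_image_Eu[OF st] split(2)[OF st(1)] by blast
  ultimately show ?thesis using splitting_unique(2)[OF splitting[OF t]] by simp
qed

lemma pullback_V:
  assumes "0 \<le> r" "r \<le> s" "s \<le> t"
  shows "pullback r t (V t s x) = pullback r s x"
proof (rule pullback_eqI)
  show "V t r (pullback r s x) = Pu t (V t s x)"
    using V_comp[OF assms, of "pullback r s x"] assms by (simp add: V_pullback Pu_V)
qed (use assms pullback_in_Eu in auto)

lemma V_pullback_comp:
  assumes "0 \<le> r" "r \<le> s" "s \<le> t"
  shows "V s r (pullback r t x) = pullback s t x"
proof (rule pullback_eqI[symmetric])
  show "V s r (pullback r t x) \<in> Eu s"
    using V_image_Eu[OF assms(1,2)] pullback_in_Eu[of r t x] assms by auto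
  show "V t s (V s r (pullback r t x)) = Pu t x"
    using assms by (simp add: V_comp V_pullback)
qed (use assms in auto)

text \<open>Linearity comes from the uniqueness of preimages and continuity from the homeomorphism.
  Boundedness is what turns the assumed \<open>onorm\<close> estimate into a bound on
  vectors.\<close>

lemma linear_pullback:
  assumes st: "0 \<le> s" "s \<le> t"
  shows "bounded_linear (pullback s t)"
proof (rule linear_continuous_bounded_linear)
  have t: "0 \<le> t" using st by simp
  show "linear (pullback s t)"
  proof (rule linearI; rule pullback_eqI[OF st])
    fix x y and c :: real
    show "pullback s t x + pullback s t y \<in> Eu s" "c *\<^sub>R pullback s t x \<in> Eu s"
      by (intro subspace_add subspace_scale subspace_Eu pullback_in_Eu st)+
    show "V t s (pullback s t x + pullback s t y) = Pu t (x + y)"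
      by (simp add: linear_simps(1)[OF linear_V[OF st]] linear_simps(1)[OF linear_Pu[OF t]] V_pullback[OF st])
    show "V t s (c *\<^sub>R pullback s t x) = Pu t (c *\<^sub>R x)"
      by (simp add: linear_simps(5)[OF linear_V[OF st]] linear_simps(5)[OF linear_Pu[OF t]] V_pullback[OF st])
  qed
  have "continuous_on (Eu t) (inv_into (Eu s) (V t s))"
    using V_Eu[OF st] by (simp add: homeomorphism_def)
  then have "continuous_on UNIV (pullback s t)"
    unfolding pullback_def
    by (rule continuous_on_compose2[OF _ linear_continuous_on[OF linear_Pu[OF t]]]) (use split t in auto)
  then show "continuous (at 0) (pullback s t)" by (simp add: continuous_on_eq_continuous_at)
qed

lemma pullback_0: "pullback 0 0 x = Pu 0 x"
  by (rule pullback_eqI) (auto simp: V_refl split)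

end

subsection \<open>Random dynamical systems\<close>

text \<open>Temperedness gives \<open>k t \<le> exp (d / 2 * t)\<close> for large \<open>t\<close>,
  so half of the decay rate survives.\<close>

lemma tempered_exp_decay:
  fixes k :: "real \<Rightarrow> real"
  assumes k: "\<And>t. 0 \<le> t \<Longrightarrow> 1 \<le> k t" and d: "0 < d"
    and lim: "((\<lambda>t. max 0 (ln (k t)) / t) \<longlongrightarrow> 0) at_top"
  shows "((\<lambda>t. k t * exp (- d * t)) \<longlongrightarrow> 0) at_top"
proof (rule Lim_null_comparison)
  have "\<forall>\<^sub>F t in at_top. max 0 (ln (k t)) / t < d / 2"
    using lim d by (intro order_tendstoD(2)) auto
  then show "\<forall>\<^sub>F t in at_top. norm (k t * exp (- d * t)) \<le> exp (- (d / 2) * t)"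
    using eventually_gt_at_top[of 0]
  proof eventually_elim
    case (elim t)
    then have "ln (k t) \<le> d / 2 * t" by (simp add: divide_less_eq)
    moreover have "0 < k t" using k[of t] elim by simp
    ultimately have "k t \<le> exp (d / 2 * t)" by (metis exp_le_cancel_iff exp_ln)
    then have "k t * exp (- d * t) \<le> exp (d / 2 * t) * exp (- d * t)" by (intro mult_right_mono) auto
    also have "\<dots> = exp (- (d / 2) * t)" by (simp add: algebra_simps flip: exp_add)
    finally show ?case using \<open>0 < k t\<close> by simp
  qed
  show "((\<lambda>t. exp (- (d / 2) * t)) \<longlongrightarrow> 0) at_top"
    using d by real_asymp
qed

lemma (in prob_space) invariant_full_Int:
  assumes "invariant_full M \<theta> A" "invariant_full M \<theta> B"
  shows "invariant_full M \<theta> (A \<inter> B)"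
proof -
  have AB: "A \<in> events" "B \<in> events" "prob A = 1" "prob B = 1"
    using assms by (auto simp: invariant_full_def flow_invariant_def)
  have "AE x in M. x \<in> A" "AE x in M. x \<in> B"
    using AB by (simp_all add: AE_in_set_eq_1)
  then have "AE x in M. x \<in> A \<inter> B" by eventually_elim simp
  then have "prob (A \<inter> B) = 1" using AB by (subst (asm) AE_in_set_eq_1) auto
  moreover have "\<theta> t -` (A \<inter> B) \<inter> space M = A \<inter> B" for t
  proof -
    have "\<theta> t -` A \<inter> space M = A" "\<theta> t -` B \<inter> space M = B"
      using assms by (simp_all add: invariant_full_def flow_invariant_def)
    then show ?thesis by blast
  qed
  ultimately show ?thesis using AB by (simp add: invariant_full_def flow_invariant_def)
qed

text \<open>The nonlinearity is measurable only where \<open>u\<close> lies in its ball; its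
  extension by zero is measurable everywhere and agrees with it wherever the cut-off is active,
  since there \<open>norm u < 2 * \<rho> \<omega> \<le> \<rho>0 \<omega>\<close>.\<close>

lemma cutoff_measurable:
  fixes F :: "'w \<Rightarrow> 'h::{real_normed_vector, second_countable_topology} \<Rightarrow> 'h"
  assumes \<sigma>: "cutoff_function \<sigma>"
    and \<rho>: "\<rho> \<in> borel_measurable M" and \<rho>0: "\<rho>0 \<in> borel_measurable M"
    and le: "\<And>\<omega>. \<omega> \<in> space M \<Longrightarrow> 2 * \<rho> \<omega> \<le> \<rho>0 \<omega>"
    and F: "(\<lambda>\<omega>. F \<omega> u) \<in> borel_measurable (restrict_space M {\<omega> \<in> space M. u \<in> ball 0 (\<rho>0 \<omega>)})"
  shows "(\<lambda>\<omega>. cutoff \<sigma> \<rho> F \<omega> u) \<in> borel_measurable M"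
proof -
  let ?B = "{\<omega> \<in> space M. u \<in> ball 0 (\<rho>0 \<omega>)}"
  have B: "?B \<in> sets M" using \<rho>0 by simp
  then have F': "(\<lambda>\<omega>. indicator ?B \<omega> *\<^sub>R F \<omega> u) \<in> borel_measurable M"
    using F by (subst (asm) borel_measurable_restrict_space_iff) auto
  have "\<sigma> field_differentiable (at s)" for s
    using \<sigma> unfolding cutoff_function_def by (metis funpow_0)
  then have "continuous_on UNIV \<sigma>"
    by (auto simp: continuous_on_eq_continuous_at intro: field_differentiable_imp_continuous_at)
  then have "\<sigma> \<in> borel_measurable borel" by (rule borel_measurable_continuous_onI)
  then have "(\<lambda>\<omega>. if norm u < 2 * \<rho> \<omega> then \<sigma> (norm u / \<rho> \<omega>) *\<^sub>R indicator ?B \<omega> *\<^sub>R F \<omega> u else 0)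
      \<in> borel_measurable M"
    using \<rho> F' by measurable
  also have "?this \<longleftrightarrow> ?thesis"
    unfolding cutoff_def
    by (rule measurable_cong) (use le in \<open>fastforce split: split_indicator\<close>)
  finally show ?thesis .
qed

lemma fundamental_solution_evolution_family:
  fixes V :: "real \<Rightarrow> real \<Rightarrow> 'h \<Rightarrow> 'h::{real_inner, banach, second_countable_topology}"
  assumes "fundamental_solution D A V"
  shows "evolution_family V"
proof (rule evolution_family.intro)
  note F = assms[unfolded fundamental_solution_def, THEN conjunct2]
  note V = F[THEN conjunct1] F[THEN conjunct2, THEN conjunct1]
    F[THEN conjunct2, THEN conjunct2, THEN conjunct1]
    F[THEN conjunct2, THEN conjunct2, THEN conjunct2, THEN conjunct1]
  show "bounded_linear (V t s)" if "0 \<le> s" "s \<le> t" for s t using V(1) that by blast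
  show "V s s x = x" for s x using V(2) by blast
  show "V t s (V s r x) = V t r x" if "0 \<le> r" "r \<le> s" "s \<le> t" for r s t x using V(3) that by blast
  show "continuous_on {(t, s). 0 \<le> s \<and> s \<le> t} (\<lambda>(t, s). V t s x)" for x
    by (rule continuous_on_subset[OF V(4)[rule_format]]) auto
qed

theorem theorem4p2:
  fixes M :: "'w measure" and \<theta> :: "real \<Rightarrow> 'w \<Rightarrow> 'w"
    and D :: "'w \<Rightarrow> 'h::{real_inner, banach, second_countable_topology} set"
    and A :: "'w \<Rightarrow> 'h \<Rightarrow> 'h" and U :: "real \<Rightarrow> 'w \<Rightarrow> 'h \<Rightarrow> 'h"
    and \<Omega>' :: "'w set" and Es Eu :: "'w \<Rightarrow> 'h set" and Ps Pu :: "'w \<Rightarrow> 'h \<Rightarrow> 'h"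
    and \<alpha> \<beta> K \<rho>0 Bt \<rho> B1 :: "'w \<Rightarrow> real" and \<epsilon> :: real
    and F :: "'w \<Rightarrow> 'h \<Rightarrow> 'h" and \<sigma> :: "real \<Rightarrow> real"
  assumes rds: "linear_rds M \<theta> D A U"
    and hyp: "pseudo_hyperbolic M \<theta> U \<Omega>' Es Eu Ps Pu \<alpha> \<beta> K"
    and \<rho>0: "pos_random_variable M \<rho>0" "tempered_below M \<theta> \<rho>0" "path_locally_integrable M \<theta> \<rho>0"
    and \<epsilon>: "0 < \<epsilon>" "\<epsilon> \<le> 1"
    and Bt: "pos_random_variable M Bt" "tempered M \<theta> Bt" "path_locally_integrable M \<theta> Bt"
    and F_measurable: "\<And>u. (\<lambda>\<omega>. F \<omega> u)
          \<in> borel_measurable (restrict_space M {\<omega> \<in> space M. u \<in> ball 0 (\<rho>0 \<omega>)})"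
    and F_lipschitz: "\<And>\<omega>. \<omega> \<in> space M \<Longrightarrow> \<exists>L. L-lipschitz_on (ball 0 (\<rho>0 \<omega>)) (F \<omega>)"
    and F_0: "\<And>\<omega>. \<omega> \<in> space M \<Longrightarrow> F \<omega> 0 = 0"
    and F_local: "\<And>\<omega> u v. \<omega> \<in> space M \<Longrightarrow> u \<in> ball 0 (\<rho>0 \<omega>) \<Longrightarrow> v \<in> ball 0 (\<rho>0 \<omega>) \<Longrightarrow>
          norm (F \<omega> u - F \<omega> v) \<le> Bt \<omega> * (norm u powr \<epsilon> + norm v powr \<epsilon>) * norm (u - v)"
    and \<rho>: "pos_random_variable M \<rho>" "tempered_below M \<theta> \<rho>" "path_locally_integrable M \<theta> \<rho>"
    and \<rho>_le: "\<And>\<omega>. \<omega> \<in> space M \<Longrightarrow> 2 * \<rho> \<omega> \<le> \<rho>0 \<omega>"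
    and \<sigma>: "cutoff_function \<sigma>"
    and B1: "pos_random_variable M B1" "tempered M \<theta> B1" "path_locally_integrable M \<theta> B1"
    and F\<rho>_lipschitz: "\<And>\<omega> u v. \<omega> \<in> space M \<Longrightarrow>
          norm (cutoff \<sigma> \<rho> F \<omega> u - cutoff \<sigma> \<rho> F \<omega> v) \<le> B1 \<omega> * \<rho> \<omega> powr \<epsilon> * norm (u - v)"
    and \<rho>_small: "\<And>\<omega>. \<omega> \<in> \<Omega>' \<Longrightarrow>
          \<rho> \<omega> < ((\<alpha> \<omega> - \<beta> \<omega>) / (8 * K \<omega> * B1 \<omega>)) powr (1 / \<epsilon>)"
  shows "\<exists>S. invariant_full M \<theta> S \<and> S \<subseteq> \<Omega>' \<and>
    (\<exists>h :: 'w \<Rightarrow> 'h \<Rightarrow> 'h. \<forall>\<omega>\<in>S.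
       pseudo_stable_set \<theta> U (cutoff \<sigma> \<rho> F) (\<lambda>\<omega>. (\<alpha> \<omega> + \<beta> \<omega>) / 2) \<omega> = {q + h \<omega> q | q. q \<in> Es \<omega>}
     \<and> h \<omega> ` Es \<omega> \<subseteq> Eu \<omega>
     \<and> (\<exists>L. L-lipschitz_on (Es \<omega>) (h \<omega>))
     \<and> h \<omega> 0 = 0)"
proof -
  interpret linear_rds M \<theta> D A U by (rule rds)
  let ?G = "cutoff \<sigma> \<rho> F"
  note F = hyp[unfolded pseudo_hyperbolic_def]
  note F5 = F[THEN conjunct2, THEN conjunct2, THEN conjunct2, THEN conjunct2]
  note F9 = F5[THEN conjunct2, THEN conjunct2, THEN conjunct2, THEN conjunct2]
  note F12 = F9[THEN conjunct2, THEN conjunct2, THEN conjunct2]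
  note hyps = F[THEN conjunct1] F[THEN conjunct2, THEN conjunct1] F5[THEN conjunct1]
    F9[THEN conjunct1] F9[THEN conjunct2, THEN conjunct1]
    F9[THEN conjunct2, THEN conjunct2, THEN conjunct1]
    F12[THEN conjunct1] F12[THEN conjunct2, THEN conjunct1] F12[THEN conjunct2, THEN conjunct2]
  \<comment> \<open>Temperedness of \<open>K\<close> holds on an invariant set of its own, which is
    later intersected with the set of the splitting.\<close>
  obtain SK where SK: "invariant_full M \<theta> SK"
    and K_lim: "\<And>\<omega>. \<omega> \<in> SK \<Longrightarrow> ((\<lambda>t. max 0 (ln (K (\<theta> t \<omega>))) / t) \<longlongrightarrow> 0) at_top"
    using hyps(7) unfolding tempered_def by (elim exE conjE) simp
  have \<Omega>'_inv: "\<theta> t -` \<Omega>' \<inter> space M = \<Omega>'" for t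
    using hyps(1) by (simp add: invariant_full_def flow_invariant_def)
  then have \<Omega>'_space: "\<omega> \<in> space M" and \<Omega>'_inv: "\<theta> t \<omega> \<in> \<Omega>'" if "\<omega> \<in> \<Omega>'" for \<omega> t
    using that by blast+
  have splits: "splitting_projections (Es \<omega>) (Eu \<omega>) (Ps \<omega>) (Pu \<omega>)" if "\<omega> \<in> \<Omega>'" for \<omega>
    using hyps(2) that by simp
  have U_Es: "U t \<omega> ` Es \<omega> \<subseteq> Es (\<theta> t \<omega>)"
    and U_Eu: "homeomorphism (Eu \<omega>) (Eu (\<theta> t \<omega>)) (U t \<omega>) (inv_into (Eu \<omega>) (U t \<omega>))"
    if "\<omega> \<in> \<Omega>'" "0 \<le> t" for \<omega> t
    using hyps(3) that by simp_all
  have rates: "\<alpha> (\<theta> t \<omega>) = \<alpha> \<omega>" "\<beta> (\<theta> t \<omega>) = \<beta> \<omega>" "\<beta> \<omega> < \<alpha> \<omega>" "1 \<le> K \<omega>"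
    if "\<omega> \<in> \<Omega>'" for \<omega> t
    using hyps(4,5,6) that by simp_all
  have bound_s: "onorm (\<lambda>x. U t \<omega> (Ps \<omega> x)) \<le> K \<omega> * exp (\<beta> \<omega> * t)"
    if "\<omega> \<in> \<Omega>'" "0 \<le> t" for \<omega> t
    using hyps(8) that by simp
  have bound_u: "onorm (\<lambda>x. inv_into (Eu (\<theta> t \<omega>)) (U (- t) (\<theta> t \<omega>)) (Pu \<omega> x)) \<le> K \<omega> * exp (\<alpha> \<omega> * t)"
    if "\<omega> \<in> \<Omega>'" "t \<le> 0" for \<omega> t
    using hyps(9) that by simp
  have G_0: "?G \<omega> 0 = 0" if "\<omega> \<in> space M" for \<omega>
    by (simp add: cutoff_def F_0[OF that])
  have G_small: "K \<omega> * norm (?G \<omega> x - ?G \<omega> y) \<le> (\<alpha> \<omega> - \<beta> \<omega>) / 8 * norm (x - y)"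
    if \<omega>: "\<omega> \<in> \<Omega>'" for \<omega> x y
  proof -
    have sp: "\<omega> \<in> space M" by (rule \<Omega>'_space[OF \<omega>])
    have pos: "0 < \<rho> \<omega>" "0 < B1 \<omega>" "0 < K \<omega>" "0 < \<alpha> \<omega> - \<beta> \<omega>"
      using \<rho>(1) B1(1) sp rates(3,4)[OF \<omega>] by (auto simp: pos_random_variable_def)
    \<comment> \<open>Raising the bound on \<open>\<rho>\<close> to the power
      \<open>\<epsilon>\<close> cancels the root and bounds \<open>K\<close> times the Lipschitz
      constant by one eighth of the spectral gap.\<close>
    have "\<rho> \<omega> powr \<epsilon> < (((\<alpha> \<omega> - \<beta> \<omega>) / (8 * K \<omega> * B1 \<omega>)) powr (1 / \<epsilon>)) powr \<epsilon>"
      using \<rho>_small[OF \<omega>] pos \<epsilon> by (intro powr_less_mono2) auto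
    also have "\<dots> = (\<alpha> \<omega> - \<beta> \<omega>) / (8 * K \<omega> * B1 \<omega>)"
      using pos \<epsilon> by (simp add: powr_powr)
    finally have "K \<omega> * (B1 \<omega> * \<rho> \<omega> powr \<epsilon>) \<le> (\<alpha> \<omega> - \<beta> \<omega>) / 8"
      using pos by (simp add: field_simps)
    then have "K \<omega> * (B1 \<omega> * \<rho> \<omega> powr \<epsilon>) * norm (x - y) \<le> (\<alpha> \<omega> - \<beta> \<omega>) / 8 * norm (x - y)"
      by (rule mult_right_mono) simp
    moreover have "K \<omega> * norm (?G \<omega> x - ?G \<omega> y) \<le> K \<omega> * (B1 \<omega> * \<rho> \<omega> powr \<epsilon> * norm (x - y))"
      using F\<rho>_lipschitz[OF sp] pos by (intro mult_left_mono) auto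
    ultimately show ?thesis by (simp add: mult.assoc)
  qed
  have G_measurable: "(\<lambda>\<omega>. ?G \<omega> x) \<in> borel_measurable M" for x
    by (rule cutoff_measurable[OF \<sigma> _ _ \<rho>_le F_measurable])
      (use \<rho>(1) \<rho>0(1) in \<open>auto simp: pos_random_variable_def\<close>)
  have "\<exists>h. pseudo_stable_set \<theta> U ?G (\<lambda>\<omega>. (\<alpha> \<omega> + \<beta> \<omega>) / 2) \<omega> = {q + h q | q. q \<in> Es \<omega>}
       \<and> h ` Es \<omega> \<subseteq> Eu \<omega> \<and> (\<exists>L. L-lipschitz_on (Es \<omega>) h) \<and> h 0 = 0"
    if \<omega>: "\<omega> \<in> \<Omega>' \<inter> SK" for \<omega>
  proof -

    \<comment> \<open>The equation along a single orbit\<close>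
    have \<omega>': "\<omega> \<in> \<Omega>'" and sp: "\<omega> \<in> space M" using \<omega> \<Omega>'_space by auto
    have inv: "\<theta> t \<omega> \<in> \<Omega>'" and sp': "\<theta> t \<omega> \<in> space M" for t
      using \<Omega>'_inv[OF \<omega>'] \<Omega>'_space by auto
    have flow: "\<theta> t (\<theta> s \<omega>) = \<theta> (t + s) \<omega>" for t s by (rule flow_add[OF sp])
    have flow0: "\<theta> 0 \<omega> = \<omega>" by (rule flow_0[OF sp])
    define V where "V t s = U (t - s) (\<theta> s \<omega>)" for t s
    have fs: "fundamental_solution (\<lambda>t. D (\<theta> t \<omega>)) (\<lambda>t. A (\<theta> t \<omega>)) V"
      using generated[OF sp] unfolding V_def .
    interpret evolution_family V
      by (rule fundamental_solution_evolution_family[OF fs])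
    interpret split_evolution V "\<lambda>t. Es (\<theta> t \<omega>)" "\<lambda>t. Eu (\<theta> t \<omega>)" "\<lambda>t. Ps (\<theta> t \<omega>)" "\<lambda>t. Pu (\<theta> t \<omega>)"
    proof (intro split_evolution.intro split_evolution_axioms.intro evolution_family_axioms)
      fix s t :: real
      show "splitting_projections (Es (\<theta> t \<omega>)) (Eu (\<theta> t \<omega>)) (Ps (\<theta> t \<omega>)) (Pu (\<theta> t \<omega>))"
        by (rule splits[OF inv])
      assume "s \<le> t"
      then show "V t s ` Es (\<theta> s \<omega>) \<subseteq> Es (\<theta> t \<omega>)"
        and "homeomorphism (Eu (\<theta> s \<omega>)) (Eu (\<theta> t \<omega>)) (V t s) (inv_into (Eu (\<theta> s \<omega>)) (V t s))"
        using U_Es[OF inv, of "t - s" s] U_Eu[OF inv, of "t - s" s] by (simp_all add: V_def flow)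
    qed
    have V_Ps: "norm (V t s (Ps (\<theta> s \<omega>) x)) \<le> K (\<theta> s \<omega>) * exp (\<beta> \<omega> * (t - s)) * norm x"
      if "s \<le> t" for s t x
    proof -
      have "bounded_linear (\<lambda>x. U (t - s) (\<theta> s \<omega>) (Ps (\<theta> s \<omega>) x))"
        using bounded_linear_compose[of "U (t - s) (\<theta> s \<omega>)" "Ps (\<theta> s \<omega>)"]
          bounded_linear_U[OF _ sp'] splits[OF inv] that by (simp add: splitting_projections_def)
      note onorm[OF this, of x]
      also have "onorm (\<lambda>x. U (t - s) (\<theta> s \<omega>) (Ps (\<theta> s \<omega>) x)) * norm x
          \<le> K (\<theta> s \<omega>) * exp (\<beta> \<omega> * (t - s)) * norm x"
        using mult_right_mono[OF bound_s[OF inv[of s], of "t - s"] norm_ge_zero[of x]] that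
        unfolding rates(2)[OF \<omega>'] by simp
      finally show ?thesis unfolding V_def .
    qed
    have pullback_le: "norm (pullback s t x) \<le> K (\<theta> t \<omega>) * exp (\<alpha> \<omega> * (s - t)) * norm x"
      if "0 \<le> s" "s \<le> t" for s t x
    proof -
      \<comment> \<open>The backward estimate is assumed at a base point for negative times; here
        the base point is \<open>\<theta> t \<omega>\<close> and the time is
        \<open>s - t\<close>.\<close>
      have "pullback s t = (\<lambda>x. inv_into (Eu (\<theta> (s - t) (\<theta> t \<omega>))) (U (- (s - t)) (\<theta> (s - t) (\<theta> t \<omega>))) (Pu (\<theta> t \<omega>) x))"
        by (simp add: pullback_def V_def flow fun_eq_iff)
      then have "onorm (pullback s t) \<le> K (\<theta> t \<omega>) * exp (\<alpha> \<omega> * (s - t))"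
        using bound_u[OF inv[of t], of "s - t"] that rates(1)[OF \<omega>'] by simp
      from onorm[OF linear_pullback[OF that], of x] mult_right_mono[OF this norm_ge_zero[of x]]
      show ?thesis by simp
    qed
    \<comment> \<open>Invariance makes \<open>\<alpha>\<close> and \<open>\<beta>\<close> constants
      along the orbit, while \<open>K\<close> becomes the function \<open>\<kappa>\<close> of
      time.\<close>
    interpret dichotomous_evolution V "\<lambda>\<tau>. ?G (\<theta> \<tau> \<omega>)" "(\<alpha> \<omega> - \<beta> \<omega>) / 8" "pullback 0"
      "\<lambda>t. K (\<theta> t \<omega>)" "\<alpha> \<omega>" "\<beta> \<omega>"
    proof (intro dichotomous_evolution.intro dichotomous_evolution_axioms.intro
        semilinear_evolution.intro semilinear_evolution_axioms.intro evolution_family_axioms)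
      fix \<tau> s t :: real and x y :: 'h
      have "(\<lambda>\<tau>. \<theta> \<tau> \<omega>) \<in> measurable borel M"
        using measurable_compose[OF measurable_Pair2'[OF sp] flow_measurable] by simp
      then show "(\<lambda>\<tau>. ?G (\<theta> \<tau> \<omega>) x) \<in> borel_measurable borel"
        by (rule measurable_compose[OF _ G_measurable])
      show "?G (\<theta> \<tau> \<omega>) 0 = 0" by (rule G_0[OF sp'])
      show small: "K (\<theta> \<tau> \<omega>) * norm (?G (\<theta> \<tau> \<omega>) x - ?G (\<theta> \<tau> \<omega>) y) \<le> (\<alpha> \<omega> - \<beta> \<omega>) / 8 * norm (x - y)"
        using G_small[OF inv[of \<tau>]] rates(1,2)[OF \<omega>'] by simp
      \<comment> \<open>As \<open>K\<close> is at least \<open>1\<close>, the smallness condition is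
        also a Lipschitz bound uniform in time.\<close>
      have "1 * norm (?G (\<theta> \<tau> \<omega>) x - ?G (\<theta> \<tau> \<omega>) y) \<le> K (\<theta> \<tau> \<omega>) * norm (?G (\<theta> \<tau> \<omega>) x - ?G (\<theta> \<tau> \<omega>) y)"
        by (intro mult_right_mono rates(4)[OF inv]) simp
      with small show "norm (?G (\<theta> \<tau> \<omega>) x - ?G (\<theta> \<tau> \<omega>) y) \<le> (\<alpha> \<omega> - \<beta> \<omega>) / 8 * norm (x - y)"
        by simp
      show "1 \<le> K (\<theta> \<tau> \<omega>)" by (rule rates(4)[OF inv])
      show gap: "\<beta> \<omega> < \<alpha> \<omega>" by (rule rates(3)[OF \<omega>'])
      then show "0 \<le> (\<alpha> \<omega> - \<beta> \<omega>) / 8" by simp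
      show "((\<lambda>t. K (\<theta> t \<omega>) * exp (- ((\<alpha> \<omega> - \<beta> \<omega>) / 2) * t)) \<longlongrightarrow> 0) at_top"
        by (rule tempered_exp_decay[OF rates(4)[OF inv] _ K_lim]) (use gap \<omega> in auto)
    next
      fix \<tau> :: real and x assume \<tau>: "0 \<le> \<tau>"
      show "bounded_linear (pullback 0 \<tau>)" by (rule linear_pullback[OF order_refl \<tau>])
      show "pullback 0 0 (pullback 0 \<tau> x) = pullback 0 \<tau> x"
        using Pu_Eu[OF order_refl pullback_in_Eu[OF order_refl \<tau>]] by (simp add: pullback_0)
      fix t assume t: "\<tau> \<le> t"
      show "pullback 0 t (V t \<tau> x) = pullback 0 \<tau> x" by (rule pullback_V[OF order_refl \<tau> t])
      have "x - V \<tau> 0 (pullback 0 \<tau> x) = Ps (\<theta> \<tau> \<omega>) x"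
        using split(3)[OF \<tau>, of x] V_pullback[OF order_refl \<tau>, of x] by (simp add: algebra_simps)
      then show "norm (V t \<tau> (x - V \<tau> 0 (pullback 0 \<tau> x))) \<le> K (\<theta> \<tau> \<omega>) * exp (\<beta> \<omega> * (t - \<tau>)) * norm x"
        using V_Ps[OF t] by simp
    next
      fix t \<tau> :: real and x assume t: "0 \<le> t" "t \<le> \<tau>"
      show "norm (V t 0 (pullback 0 \<tau> x)) \<le> K (\<theta> \<tau> \<omega>) * exp (\<alpha> \<omega> * (t - \<tau>)) * norm x"
        unfolding V_pullback_comp[OF order_refl t] by (rule pullback_le[OF t])
    qed
    \<comment> \<open>At time \<open>0\<close> the operator \<open>J\<close> is the unstable
      projection, whose kernel is the stable space.\<close>
    have ker: "{q. pullback 0 0 q = 0} = Es \<omega>"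
    proof -
      have "q \<in> Es \<omega> \<longleftrightarrow> Pu (\<theta> 0 \<omega>) q = 0" for q
        using Pu_Es[OF order_refl, of q] split(1,3)[OF order_refl, of q] flow0 by auto
      then show ?thesis by (auto simp: pullback_0)
    qed
    have mild: "mild_solution \<theta> U ?G \<omega> u \<longleftrightarrow> mild u" for u
      unfolding mild_solution_def mild_def V_def ..
    have "pseudo_stable_set \<theta> U ?G (\<lambda>\<omega>. (\<alpha> \<omega> + \<beta> \<omega>) / 2) \<omega> = {u 0 | u c. mild u \<and> growth_le c u}"
      using stable_set_eq by (simp add: pseudo_stable_set_def the_solution_def mild \<gamma>_def)
    also have "\<dots> = {q + graph_map q | q. q \<in> Es \<omega>}"
      unfolding lyapunov_perron(1) ker[symmetric] by simp
    finally have "pseudo_stable_set \<theta> U ?G (\<lambda>\<omega>. (\<alpha> \<omega> + \<beta> \<omega>) / 2) \<omega> = {q + graph_map q | q. q \<in> Es \<omega>}" .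
    moreover have "graph_map q \<in> Eu \<omega>" if "q \<in> Es \<omega>" for q
    proof -
      have "pullback 0 0 (graph_map q) = graph_map q"
        using that ker by (intro lyapunov_perron(2)) blast
      then show ?thesis using pullback_in_Eu[of 0 0 "graph_map q"] by (simp add: flow0)
    qed
    moreover have "(K (\<theta> 0 \<omega>) / 2)-lipschitz_on (Es \<omega>) graph_map"
      using lyapunov_perron(3) unfolding ker .
    ultimately show ?thesis using lyapunov_perron(4) by blast
  qed
  \<comment> \<open>The maps found orbit by orbit are collected into one function by choice over the
    sample points.\<close>
  from bchoice[OF ballI, OF this] obtain h where "\<forall>\<omega>\<in>\<Omega>' \<inter> SK.
       pseudo_stable_set \<theta> U ?G (\<lambda>\<omega>. (\<alpha> \<omega> + \<beta> \<omega>) / 2) \<omega> = {q + h \<omega> q | q. q \<in> Es \<omega>}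
     \<and> h \<omega> ` Es \<omega> \<subseteq> Eu \<omega> \<and> (\<exists>L. L-lipschitz_on (Es \<omega>) (h \<omega>)) \<and> h \<omega> 0 = 0"
    ..
  with invariant_full_Int[OF hyps(1) SK] Int_lower1 show ?thesis
    by (intro exI[of _ "\<Omega>' \<inter> SK"] conjI exI[of _ h])
qed

end
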